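(* For any link $L$ with at least $2$ components, any $L$-generating subset of the directed oriented Reidemeister moves contains at least one forward move of type $\Omega2$ and at least one backward move of type $\Omega2$.
   Context: Links are oriented; link diagrams are oriented generic planar diagrams in $\mathbb{R}^2$, up to planar isotopy. Directed oriented Reidemeister moves are the 32 types of moves obtained from the 16 types of oriented Reidemeister moves (four of type $\Omega1$, four of type $\Omega2$, eight of type $\Omega3$, distinguished by orientations and over/under information of the strands) by distinguishing the two directions (forward $\uparrow$, backward $\downarrow$) in which each may be performed. A move of type $\Omega1$ (creating/removing a curl with one crossing) or $\Omega2$ (pushing one arc over a neighbouring arc, creating two crossings bounding a bigon, or the inverse) is forward if it increases the number of crossings and backward if it decreases it. An $\Omega3$ move passes a strand across the crossing of two other strands, where the three strands (top, middle, bottom) pairwise cross once. For an $\Omega3$ move, orient the triangle formed by the three crossings by the cyclic order bottom$\to$middle$\to$top of its sides; let $n$ be the number of sides on which this orientation agrees with that of the diagram, $q=(-1)^n$; the move is forward if it changes $q=-1$ to $q=+1$ and backward otherwise. A set $A$ of directed moves is $L$-generating if for any two diagrams $L_1,L_2$ of $L$, $L_2$ can be obtained from $L_1$ by a finite sequence of moves from $A$ (each used only in its specified direction). *)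

theory Defs
  imports "HOL-Complex_Analysis.Winding_Numbers"
begin

text \<open>
  The plane is \<^typ>\<open>complex\<close> and 3-space is \<^typ>\<open>complex \<times> real\<close>; diagrams are taken with respect to
  the projection \<^const>\<open>fst\<close>, and \<^const>\<open>snd\<close> is the height.  An oriented closed curve is a
  continuous 1-periodic function on the real line, and a system of curves is the list of its
  components.  A parameter point is a pair of a component index and a time, and times that differ
  by an integer denote the same point.
\<close>

type_synonym 'a curves = "(real \<Rightarrow> 'a) list"
type_synonym param = "nat \<times> real"

definition closed_curve :: "(real \<Rightarrow> 'a::topological_space) \<Rightarrow> bool" where
  "closed_curve c \<longleftrightarrow> continuous_on UNIV c \<and> (\<forall>t. c (t + 1) = c t)"

definition point :: "'a curves \<Rightarrow> param \<Rightarrow> 'a" where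
  "point C x = (C ! fst x) (snd x)"

definition same_param :: "param \<Rightarrow> param \<Rightarrow> bool" where
  "same_param x y \<longleftrightarrow> fst x = fst y \<and> snd x - snd y \<in> \<int>"

definition double :: "'a curves \<Rightarrow> param \<Rightarrow> param \<Rightarrow> bool" where
  "double C x y \<longleftrightarrow> fst x < length C \<and> fst y < length C \<and> point C x = point C y \<and> \<not> same_param x y"

definition ambient_isotopy :: "(real \<Rightarrow> 'a \<Rightarrow> 'a::topological_space) \<Rightarrow> bool" where
  "ambient_isotopy H \<longleftrightarrow>
     continuous_on ({0..1} \<times> UNIV) (\<lambda>(t, x). H t x) \<and>
     (\<forall>t\<in>{0..1}. \<exists>G. homeomorphism UNIV UNIV (H t) G) \<and>
     H 0 = id"

definition reparametrization :: "(real \<Rightarrow> real) \<Rightarrow> bool" where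
  "reparametrization f \<longleftrightarrow> continuous_on UNIV f \<and> strict_mono f \<and> (\<forall>t. f (t + 1) = f t + 1)"

text \<open>
  \<open>carries h \<sigma> f C C'\<close>: the map \<open>h\<close> takes the oriented curves \<open>C\<close> to the oriented curves \<open>C'\<close>,
  where components are unordered (\<open>\<sigma>\<close> matches them) and parametrizations are irrelevant.
\<close>
definition carries ::
    "('a \<Rightarrow> 'a) \<Rightarrow> (nat \<Rightarrow> nat) \<Rightarrow> (nat \<Rightarrow> real \<Rightarrow> real) \<Rightarrow> 'a curves \<Rightarrow> 'a curves \<Rightarrow> bool" where
  "carries h \<sigma> f C C' \<longleftrightarrow>
     length C = length C' \<and> bij_betw \<sigma> {..<length C} {..<length C} \<and>
     (\<forall>i<length C. reparametrization (f i) \<and> (\<forall>t. h ((C ! i) t) = (C' ! \<sigma> i) (f i t)))"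


section \<open>Links\<close>

type_synonym space = "complex \<times> real"

definition link :: "space curves \<Rightarrow> bool" where
  "link K \<longleftrightarrow> (\<forall>c\<in>set K. closed_curve c) \<and> (\<forall>x y. \<not> double K x y)"

definition isotopic :: "space curves \<Rightarrow> space curves \<Rightarrow> bool" where
  "isotopic K K' \<longleftrightarrow> link K \<and> link K' \<and> (\<exists>H \<sigma> f. ambient_isotopy H \<and> carries (H 1) \<sigma> f K K')"

definition polygonal :: "(real \<Rightarrow> 'a::real_vector) \<Rightarrow> bool" where
  "polygonal c \<longleftrightarrow>
     (\<exists>S. finite S \<and>
        (\<forall>a b. 0 \<le> a \<and> a < b \<and> b \<le> 1 \<and> {a<..<b} \<inter> S = {} \<longrightarrow>
           (\<exists>p v. \<forall>t\<in>{a..b}. c t = p + t *\<^sub>R v)))"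

text \<open>Wild links, which have no diagrams, are excluded in the usual way.\<close>
definition tame_link :: "space curves \<Rightarrow> bool" where
  "tame_link K \<longleftrightarrow> (\<exists>P. isotopic K P \<and> (\<forall>c\<in>set P. polygonal c))"


section \<open>Link diagrams\<close>

text \<open>
  \<open>over D x\<close> says that at \<open>x\<close> the diagram runs along the upper strand of the crossing that \<open>x\<close>
  belongs to; its value at parameter points that belong to no crossing carries no information.
\<close>
record diagram =
  strands :: "complex curves"
  over :: "param \<Rightarrow> bool"

definition velocity :: "complex curves \<Rightarrow> param \<Rightarrow> complex" where
  "velocity C x = vector_derivative (C ! fst x) (at (snd x))"

definition cross :: "complex \<Rightarrow> complex \<Rightarrow> real" where
  "cross u v = Re u * Im v - Im u * Re v"

text \<open>
  Generic curves have finitely many multiple points, all of them transverse double points.  Away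
  from these the curves are only required to be continuous, so that smooth and polygonal diagrams
  are both covered; since multiplicities are restricted, such a curve is locally an embedded arc,
  hence by the Schoenflies theorem every system as below is planar isotopic to a smooth and to a
  polygonal one.
\<close>
definition generic :: "complex curves \<Rightarrow> bool" where
  "generic C \<longleftrightarrow>
     (\<forall>c\<in>set C. closed_curve c) \<and>
     finite {point C x | x y. double C x y} \<and>
     (\<forall>x y z. double C x y \<and> double C x z \<longrightarrow> same_param y z) \<and>
     (\<forall>x y. double C x y \<longrightarrow>
        (C ! fst x) differentiable (at (snd x)) \<and>
        (C ! fst y) differentiable (at (snd y)) \<and>
        cross (velocity C x) (velocity C y) \<noteq> 0)"

definition link_diagram :: "diagram \<Rightarrow> bool" where
  "link_diagram D \<longleftrightarrow>
     generic (strands D) \<and>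
     (\<forall>x y. same_param x y \<longrightarrow> over D x = over D y) \<and>
     (\<forall>x y. double (strands D) x y \<longrightarrow> over D x \<noteq> over D y)"

definition diagram_of :: "diagram \<Rightarrow> space curves \<Rightarrow> bool" where
  "diagram_of D K \<longleftrightarrow>
     link_diagram D \<and>
     (\<exists>K'. isotopic K K' \<and>
        strands D = map (\<lambda>c. fst \<circ> c) K' \<and>
        (\<forall>x y. double (strands D) x y \<longrightarrow> over D x = (snd (point K' x) > snd (point K' y))))"

definition planar_isotopic :: "diagram \<Rightarrow> diagram \<Rightarrow> bool" where
  "planar_isotopic D D' \<longleftrightarrow>
     link_diagram D \<and> link_diagram D' \<and>
     (\<exists>H \<sigma> f. ambient_isotopy H \<and> carries (H 1) \<sigma> f (strands D) (strands D') \<and>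
        (\<forall>i s y. double (strands D) (i, s) y \<longrightarrow> over D (i, s) = over D' (\<sigma> i, f i s)))"

text \<open>The usual sign of the crossing at which \<open>x\<close> runs over \<open>y\<close>.\<close>
definition positive_crossing :: "diagram \<Rightarrow> param \<Rightarrow> param \<Rightarrow> bool" where
  "positive_crossing D x y \<longleftrightarrow> cross (velocity (strands D) x) (velocity (strands D) y) > 0"


section \<open>Oriented Reidemeister moves\<close>

text \<open>The arc \<open>(i, a, b)\<close> is the part of component \<open>i\<close> from time \<open>a\<close> to time \<open>b\<close>.\<close>
type_synonym arc = "nat \<times> real \<times> real"

fun arc_params :: "arc \<Rightarrow> param set" where
  "arc_params (i, a, b) = {i} \<times> {a..b}"

definition on_arc :: "param \<Rightarrow> arc \<Rightarrow> bool" where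
  "on_arc x \<alpha> \<longleftrightarrow> (\<exists>y\<in>arc_params \<alpha>. same_param x y)"

fun proper_arc :: "complex set \<Rightarrow> complex curves \<Rightarrow> arc \<Rightarrow> bool" where
  "proper_arc \<Delta> C (i, a, b) \<longleftrightarrow>
     i < length C \<and> a < b \<and> b < a + 1 \<and>
     point C (i, a) \<in> frontier \<Delta> \<and> point C (i, b) \<in> frontier \<Delta> \<and>
     (\<forall>t\<in>{a<..<b}. point C (i, t) \<in> interior \<Delta>)"

text \<open>The part of the curves \<open>C\<close> in the disc \<open>\<Delta>\<close> consists of the given pairwise disjoint arcs.\<close>
definition tangle :: "complex set \<Rightarrow> arc list \<Rightarrow> complex curves \<Rightarrow> bool" where
  "tangle \<Delta> as C \<longleftrightarrow>
     (\<forall>\<alpha>\<in>set as. proper_arc \<Delta> C \<alpha>) \<and>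
     (\<forall>k<length as. \<forall>l<length as. \<forall>x. on_arc x (as ! k) \<and> on_arc x (as ! l) \<longrightarrow> k = l) \<and>
     (\<forall>x. fst x < length C \<longrightarrow> (point C x \<in> \<Delta> \<longleftrightarrow> (\<exists>\<alpha>\<in>set as. on_arc x \<alpha>)))"

text \<open>
  The two diagrams differ only inside a disc, which they both meet in the given arcs (with common
  end points, by continuity).
\<close>
definition local_change :: "arc list \<Rightarrow> diagram \<Rightarrow> diagram \<Rightarrow> bool" where
  "local_change as D D' \<longleftrightarrow>
     link_diagram D \<and> link_diagram D' \<and>
     length (strands D) = length (strands D') \<and>
     (\<exists>\<Delta>. \<Delta> homeomorphic cball (0::complex) 1 \<and>
          tangle \<Delta> as (strands D) \<and> tangle \<Delta> as (strands D')) \<and>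
     (\<forall>x. fst x < length (strands D) \<and> (\<forall>\<alpha>\<in>set as. \<not> on_arc x \<alpha>) \<longrightarrow>
        point (strands D) x = point (strands D') x \<and>
        (\<forall>y. double (strands D) x y \<longrightarrow> over D x = over D' x))"

definition embedded_arc :: "complex curves \<Rightarrow> arc \<Rightarrow> bool" where
  "embedded_arc C \<alpha> \<longleftrightarrow> inj_on (point C) (arc_params \<alpha>)"

definition arc_crossings :: "complex curves \<Rightarrow> arc \<Rightarrow> arc \<Rightarrow> (param \<times> param) set" where
  "arc_crossings C \<alpha> \<beta> = {(x, y). x \<in> arc_params \<alpha> \<and> y \<in> arc_params \<beta> \<and> point C x = point C y}"

text \<open>
  In the relations \<open>omega1\<close> and \<open>omega2\<close> the second diagram is the one with more crossings.  In
  \<open>omega1\<close>, \<open>[s, t]\<close> is the curl; the type is given by the sign of the crossing and by whether the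
  curl runs counterclockwise.
\<close>
definition omega1 :: "bool \<Rightarrow> bool \<Rightarrow> diagram \<Rightarrow> diagram \<Rightarrow> bool" where
  "omega1 pos ccw D D' \<longleftrightarrow>
     (\<exists>i a b s t. local_change [(i, a, b)] D D' \<and>
        embedded_arc (strands D) (i, a, b) \<and>
        a < s \<and> s < t \<and> t < b \<and>
        {(s', t'). a \<le> s' \<and> s' < t' \<and> t' \<le> b \<and>
           point (strands D') (i, s') = point (strands D') (i, t')} = {(s, t)} \<and>
        pos = (if over D' (i, s) then positive_crossing D' (i, s) (i, t)
               else positive_crossing D' (i, t) (i, s)) \<and>
        ccw = (\<exists>z. z \<in> inside (path_image (subpath s t (strands D' ! i))) \<and>
                   winding_number (subpath s t (strands D' ! i)) z = 1))"

text \<open>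
  In \<open>omega2\<close> the arc \<open>\<alpha>\<close> is pushed over the arc \<open>\<beta>\<close>, and \<open>x\<^sub>1\<close>, \<open>x\<^sub>2\<close> are the crossings in the order
  in which \<open>\<alpha>\<close> passes them.  The arcs are parallel if \<open>\<beta>\<close> passes the crossings in the same order, and
  antiparallel otherwise.  In either case the two crossings have opposite signs, and the sign of
  the first one tells on which side of \<open>\<alpha>\<close> the arc \<open>\<beta>\<close> lies before the move: for parallel arcs it is
  negative iff \<open>\<beta>\<close> lies to the left of \<open>\<alpha>\<close>, for antiparallel arcs iff \<open>\<beta>\<close> lies to the right of \<open>\<alpha>\<close>.
  Up to isotopy this leaves exactly four local pictures.
\<close>
definition omega2 :: "bool \<Rightarrow> bool \<Rightarrow> diagram \<Rightarrow> diagram \<Rightarrow> bool" where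
  "omega2 parallel pos D D' \<longleftrightarrow>
     (\<exists>\<alpha> \<beta> x\<^sub>1 y\<^sub>1 x\<^sub>2 y\<^sub>2. local_change [\<alpha>, \<beta>] D D' \<and>
        embedded_arc (strands D) \<alpha> \<and> embedded_arc (strands D) \<beta> \<and>
        arc_crossings (strands D) \<alpha> \<beta> = {} \<and>
        embedded_arc (strands D') \<alpha> \<and> embedded_arc (strands D') \<beta> \<and>
        arc_crossings (strands D') \<alpha> \<beta> = {(x\<^sub>1, y\<^sub>1), (x\<^sub>2, y\<^sub>2)} \<and> snd x\<^sub>1 < snd x\<^sub>2 \<and>
        over D' x\<^sub>1 \<and> over D' x\<^sub>2 \<and>
        parallel = (snd y\<^sub>1 < snd y\<^sub>2) \<and>
        pos = positive_crossing D' x\<^sub>1 y\<^sub>1)"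

text \<open>
  Three arcs \<open>T\<close>, \<open>M\<close>, \<open>B\<close> (top, middle, bottom) that pairwise cross once; \<open>tM\<close> is the parameter
  point on \<open>T\<close> of the crossing with \<open>M\<close>, and so on.  The booleans are the signs of the crossings of
  \<open>T\<close> with \<open>M\<close>, of \<open>T\<close> with \<open>B\<close> and of \<open>M\<close> with \<open>B\<close>; they determine the cyclic order of the six end
  points on the boundary of the disc and vice versa, hence the eight types of moves.
  Running through the sides of the triangle in the cyclic order bottom, middle, top, one traverses
  \<open>B\<close> from \<open>T\<close> to \<open>M\<close>, then \<open>M\<close> from \<open>B\<close> to \<open>T\<close>, then \<open>T\<close> from \<open>M\<close> to \<open>B\<close>; the last argument is the
  resulting sign \<open>q\<close>.
\<close>
definition triangle ::
    "arc \<Rightarrow> arc \<Rightarrow> arc \<Rightarrow> bool \<Rightarrow> bool \<Rightarrow> bool \<Rightarrow> diagram \<Rightarrow> int \<Rightarrow> bool" where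
  "triangle T M B posTM posTB posMB D q \<longleftrightarrow>
     embedded_arc (strands D) T \<and> embedded_arc (strands D) M \<and> embedded_arc (strands D) B \<and>
     (\<exists>tM mT tB bT mB bM.
        arc_crossings (strands D) T M = {(tM, mT)} \<and> over D tM \<and>
        arc_crossings (strands D) T B = {(tB, bT)} \<and> over D tB \<and>
        arc_crossings (strands D) M B = {(mB, bM)} \<and> over D mB \<and>
        posTM = positive_crossing D tM mT \<and>
        posTB = positive_crossing D tB bT \<and>
        posMB = positive_crossing D mB bM \<and>
        q = (-1) ^ (of_bool (snd bT < snd bM) + of_bool (snd mB < snd mT) + of_bool (snd tM < snd tB)))"

definition omega3 :: "bool \<Rightarrow> bool \<Rightarrow> bool \<Rightarrow> diagram \<Rightarrow> diagram \<Rightarrow> bool" where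
  "omega3 posTM posTB posMB D D' \<longleftrightarrow>
     (\<exists>T M B. local_change [T, M, B] D D' \<and>
        triangle T M B posTM posTB posMB D (-1) \<and>
        triangle T M B posTM posTB posMB D' 1)"

text \<open>The arguments are those of \<^const>\<open>omega1\<close>, \<^const>\<open>omega2\<close> and \<^const>\<open>omega3\<close>.\<close>
datatype move_type = Omega1 bool bool | Omega2 bool bool | Omega3 bool bool bool

datatype direction = Forward | Backward

type_synonym directed_move = "move_type \<times> direction"

fun forward_move :: "move_type \<Rightarrow> diagram \<Rightarrow> diagram \<Rightarrow> bool" where
  "forward_move (Omega1 pos ccw) = omega1 pos ccw"
| "forward_move (Omega2 parallel pos) = omega2 parallel pos"
| "forward_move (Omega3 posTM posTB posMB) = omega3 posTM posTB posMB"

fun performs :: "directed_move \<Rightarrow> diagram \<Rightarrow> diagram \<Rightarrow> bool" where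
  "performs (m, Forward) D D' = forward_move m D D'"
| "performs (m, Backward) D D' = forward_move m D' D"

text \<open>Diagrams are considered up to planar isotopy, so planar isotopies may be used freely.\<close>
definition generating :: "space curves \<Rightarrow> directed_move set \<Rightarrow> bool" where
  "generating L A \<longleftrightarrow>
     (\<forall>D D'. diagram_of D L \<and> diagram_of D' L \<longrightarrow>
        (\<lambda>E E'. planar_isotopic E E' \<or> (\<exists>m\<in>A. performs m E E'))\<^sup>*\<^sup>* D D')"

end

theory Submission
  imports Defs
begin

text \<open>
  Call a crossing mixed if its two strands belong to different components of the link, and count
  the mixed crossings of a diagram.  A planar isotopy does not change this number.  A curl is made
  of one strand, so \<open>\<Omega>1\<close> does not change it either.  In \<open>\<Omega>3\<close> the same three pairs of strands cross
  before and after the move, once each, so the number is again unchanged.  Only \<open>\<Omega>2\<close> can change it,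
  and a forward \<open>\<Omega>2\<close> never lowers it, because its disc contains no crossing of the two arcs before
  the move.  Hence a sequence of moves without forward \<open>\<Omega>2\<close> cannot raise the number
  (\<open>without_forward_omega2_nonincreasing\<close>), and one without backward \<open>\<Omega>2\<close> cannot lower it
  (\<open>without_backward_omega2_nondecreasing\<close>).

  It remains to find two diagrams of the link with different numbers of mixed crossings, since a
  generating set must lead from each of them to the other.  They are projections of polygonal
  links isotopic to the given one.

  The first one comes from a general choice of the direction of projection
  (\<open>polygonal_generic_projection\<close>).  The directions in which a polygonal link fails to project to
  generic curves form a set of measure zero: they are images of finitely many null sets of parameter
  pairs under rational maps from the plane of parameters to the plane of directions.
  The delicate condition is the absence of triple points.  The lines that meet three given lines
  in different points form a one-parameter family, unless the three lines lie in a common plane; and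
  in the direction of such a plane no two of them cross transversely.

  For the second one, horizontal translations depending on the height are used.  For every
  continuous \<open>\<phi>\<close> the map \<open>(z, h) \<mapsto> (z + \<phi> h, h)\<close> is isotopic to the identity, and it moves pieces of the
  link that lie at different heights independently of each other.  Choose pieces of edges of
  two components at disjoint ranges of heights.  A piecewise linear \<open>\<phi>\<close> keeps the link polygonal and
  can be chosen such that, seen from above, the first piece zigzags across the second as often as
  desired.  These crossings survive a small change of the direction of projection, and a small
  change suffices to make the projection generic (\<open>diagram_with_many_mixed_crossings\<close>).
\<close>


section \<open>Periodic curves and parameter points\<close>

lemma closed_curve_shift:
  assumes "closed_curve c" "s - t \<in> \<int>"
  shows "c s = c t"
proof -
  have per: "c (t + 1) = c t" for t
    using assms by (auto simp: closed_curve_def)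
  have nat: "c (t + real n) = c t" for t n
  proof (induction n)
    case (Suc n)
    then show ?case using per[of "t + real n"] by (simp add: algebra_simps)
  qed simp
  obtain k where "s = t + of_int k"
    using assms(2) by (metis Ints_cases add.commute diff_add_cancel)
  moreover have "c (t + of_int k) = c t"
  proof (cases "k \<ge> 0")
    case True
    then show ?thesis using nat[of t "nat k"] by simp
  next
    case False
    then show ?thesis using nat[of "t + of_int k" "nat (- k)"] by simp
  qed
  ultimately show ?thesis by simp
qed

lemma point_same_param:
  assumes "\<forall>c\<in>set C. closed_curve c" "fst x < length C" "same_param x y"
  shows "point C x = point C y"
  using assms closed_curve_shift unfolding same_param_def point_def by (metis nth_mem)

lemma same_param_sym: "same_param x y \<longleftrightarrow> same_param y x"
  unfolding same_param_def by (metis Ints_minus minus_diff_eq)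

lemma same_param_refl [simp]: "same_param x x"
  by (simp add: same_param_def)

lemma same_param_trans: "same_param x y \<Longrightarrow> same_param y z \<Longrightarrow> same_param x z"
  unfolding same_param_def by (metis Ints_add add_diff_eq diff_add_cancel)

lemma generic_closed: "generic C \<Longrightarrow> \<forall>c\<in>set C. closed_curve c"
  by (simp add: generic_def)

lemma generic_double_unique:
  assumes "generic C" "double C x y" "double C x z"
  shows "same_param y z"
  using assms unfolding generic_def by blast

text \<open>
  Since \<open>f (t + 1) = f t + 1\<close>, the values \<open>f n\<close> are unbounded in both directions, and the
  intermediate value theorem applies.
\<close>
lemma reparametrization_surj:
  assumes "reparametrization f"
  shows "surj f"
proof -
  have cont: "continuous_on UNIV f" and per: "f (t + 1) = f t + 1" for t
    using assms by (auto simp: reparametrization_def)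
  have shift: "f (real n) = f 0 + real n" for n
  proof (induction n)
    case (Suc n)
    show ?case using per[of "real n"] Suc by (simp add: algebra_simps)
  qed simp
  have shift': "f (- real n) = f 0 - real n" for n
  proof (induction n)
    case (Suc n)
    show ?case using per[of "- real (Suc n)"] Suc by (simp add: algebra_simps)
  qed simp
  show ?thesis
  proof (rule surjI)
    fix y
    obtain n where n: "\<bar>y - f 0\<bar> \<le> real n"
      using real_arch_simple by blast
    have "\<exists>x\<ge>- real n. x \<le> real n \<and> f x = y"
      by (rule IVT') (use n shift[of n] shift'[of n] cont in \<open>auto intro: continuous_on_subset\<close>)
    then show "f (SOME x. f x = y) = y"
      by (metis (mono_tags, lifting) someI)
  qed
qed

lemma ambient_isotopy_inj:
  assumes "ambient_isotopy H" 
  shows "inj (H 1)"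
proof -
  obtain G where "homeomorphism UNIV UNIV (H 1) G"
    using assms unfolding ambient_isotopy_def by force
  then show ?thesis
    by (metis homeomorphism_apply1 injI iso_tuple_UNIV_I)
qed


section \<open>Mixed crossings and planar isotopy\<close>

text \<open>
  Mixed crossings are collected as points of the plane and not as pairs of parameter points, so that
  planar isotopies and local changes act on them simply by maps and by set difference.
\<close>
definition mixed_crossings :: "'a curves \<Rightarrow> 'a set" where
  "mixed_crossings C =
     {z. \<exists>i<length C. \<exists>j<length C. i \<noteq> j \<and> z \<in> range (C ! i) \<and> z \<in> range (C ! j)}"

definition mixed_crossing_number :: "diagram \<Rightarrow> nat" where
  "mixed_crossing_number D = card (mixed_crossings (strands D))"

lemma finite_mixed_crossings:
  assumes "generic C"
  shows "finite (mixed_crossings C)"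
proof (rule finite_subset)
  show "mixed_crossings C \<subseteq> {point C x | x y. double C x y}"
  proof
    fix z assume "z \<in> mixed_crossings C"
    then obtain i j s t where "i < length C" "j < length C" "i \<noteq> j" "z = (C ! i) s" "z = (C ! j) t"
      unfolding mixed_crossings_def by auto
    then have "z = point C (i, s) \<and> double C (i, s) (j, t)"
      by (simp add: point_def double_def same_param_def)
    then show "z \<in> {point C x | x y. double C x y}" by blast
  qed
qed (use assms in \<open>simp add: generic_def\<close>)

text \<open>
  The curve matched with \<open>C ! i\<close> has the image of \<open>C ! i\<close> under \<open>h\<close> as its range, because
  reparametrizations are onto; so the mixed crossings correspond as well.
\<close>
lemma mixed_crossings_carries:
  assumes "inj h" "carries h \<sigma> f C C'"
  shows "mixed_crossings C' = h ` mixed_crossings C"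
proof -
  have len: "length C = length C'" and bij: "bij_betw \<sigma> {..<length C} {..<length C}"
    and par: "\<And>i. i < length C \<Longrightarrow> reparametrization (f i)"
    and eq: "\<And>i t. i < length C \<Longrightarrow> h ((C ! i) t) = (C' ! \<sigma> i) (f i t)"
    using assms(2) by (auto simp: carries_def)
  have ran: "range (C' ! \<sigma> i) = h ` range (C ! i)" if "i < length C" for i
  proof -
    have "range (C' ! \<sigma> i) = range (\<lambda>t. (C' ! \<sigma> i) (f i t))"
      using reparametrization_surj[OF par[OF that]] by (metis image_image)
    also have "\<dots> = h ` range (C ! i)"
      using eq[OF that] by (simp add: image_image)
    finally show ?thesis .
  qed
  have lt: "\<sigma> i < length C" if "i < length C" for i
    using bij that by (auto simp: bij_betw_def)
  have ne: "\<sigma> i \<noteq> \<sigma> j" if "i < length C" "j < length C" "i \<noteq> j" for i j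
    using bij that by (auto simp: bij_betw_def inj_on_def)
  have onto: "\<exists>i'<length C. i = \<sigma> i'" if "i < length C" for i
    using bij that by (metis bij_betw_iff_bijections lessThan_iff)
  show ?thesis
  proof (intro equalityI subsetI)
    fix z assume "z \<in> mixed_crossings C'"
    then obtain i j where ij: "i < length C" "j < length C" "i \<noteq> j"
      "z \<in> range (C' ! i)" "z \<in> range (C' ! j)"
      unfolding mixed_crossings_def len by auto
    obtain i' j' where *: "i' < length C" "i = \<sigma> i'" "j' < length C" "j = \<sigma> j'"
      using onto ij by metis
    then have "z \<in> h ` range (C ! i')" "z \<in> h ` range (C ! j')" "i' \<noteq> j'"
      using ij ran by auto
    then have "z \<in> h ` (range (C ! i') \<inter> range (C ! j'))"
      using assms(1) by (simp add: image_Int)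
    then show "z \<in> h ` mixed_crossings C"
      using * \<open>i' \<noteq> j'\<close> unfolding mixed_crossings_def by blast
  next
    fix z assume "z \<in> h ` mixed_crossings C"
    then obtain u i j where "z = h u" "i < length C" "j < length C" "i \<noteq> j"
      "u \<in> range (C ! i)" "u \<in> range (C ! j)"
      unfolding mixed_crossings_def by auto
    then show "z \<in> mixed_crossings C'"
      using ran lt ne len unfolding mixed_crossings_def by (smt (verit) imageI mem_Collect_eq)
  qed
qed

lemma planar_isotopic_mixed_crossing_number:
  assumes "planar_isotopic D D'"
  shows "mixed_crossing_number D = mixed_crossing_number D'"
proof -
  obtain H \<sigma> f where H: "ambient_isotopy H" and c: "carries (H 1) \<sigma> f (strands D) (strands D')"
    using assms unfolding planar_isotopic_def by auto
  have "inj (H 1)"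
    using H by (rule ambient_isotopy_inj)
  then show ?thesis
    unfolding mixed_crossing_number_def mixed_crossings_carries[OF \<open>inj (H 1)\<close> c]
    by (metis card_image inj_on_subset subset_UNIV)
qed


section \<open>Mixed crossings and Reidemeister moves\<close>

text \<open>
  Inside the disc every parameter point can be shifted by an integer onto one of the arcs, and
  an arc determines its component.
\<close>
lemma tangle_mixed_crossings:
  assumes "generic C" "tangle \<Delta> as C"
  shows "mixed_crossings C \<inter> \<Delta> =
    (\<Union>\<alpha>\<in>set as. \<Union>\<beta>\<in>set as. if fst \<alpha> \<noteq> fst \<beta> then (point C \<circ> fst) ` arc_crossings C \<alpha> \<beta> else {})"
    (is "_ = ?R")
proof (intro equalityI subsetI)
  fix z assume z: "z \<in> mixed_crossings C \<inter> \<Delta>"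
  then obtain i j s t where ij: "i < length C" "j < length C" "i \<noteq> j" "z = point C (i, s)" "z = point C (j, t)"
    unfolding mixed_crossings_def point_def by auto
  have "\<exists>\<alpha>\<in>set as. on_arc (i, s) \<alpha>" "\<exists>\<alpha>\<in>set as. on_arc (j, t) \<alpha>"
    using assms(2) z ij unfolding tangle_def by (metis IntD2 fst_conv)+
  then obtain \<alpha> \<beta> x y where ab: "\<alpha> \<in> set as" "\<beta> \<in> set as"
    and x: "x \<in> arc_params \<alpha>" "same_param (i, s) x" and y: "y \<in> arc_params \<beta>" "same_param (j, t) y"
    unfolding on_arc_def by blast
  have "point C x = z" "point C y = z"
    using point_same_param[OF generic_closed[OF assms(1)]] ij x y by (metis fst_conv)+
  moreover have "fst \<alpha> = i" "fst \<beta> = j"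
    using x y by (cases \<alpha>, cases \<beta>, auto simp: same_param_def)+
  ultimately have "fst \<alpha> \<noteq> fst \<beta>" "(x, y) \<in> arc_crossings C \<alpha> \<beta>" "z = (point C \<circ> fst) (x, y)"
    using x y ij by (auto simp: arc_crossings_def)
  then show "z \<in> ?R"
    by (intro UN_I[OF ab(1)] UN_I[OF ab(2)]) (simp del: comp_apply)
next
  fix z assume "z \<in> ?R"
  then obtain \<alpha> \<beta> where ab: "\<alpha> \<in> set as" "\<beta> \<in> set as"
    and z: "z \<in> (if fst \<alpha> \<noteq> fst \<beta> then (point C \<circ> fst) ` arc_crossings C \<alpha> \<beta> else {})"
    by (elim UN_E)
  have ne: "fst \<alpha> \<noteq> fst \<beta>" and "z \<in> (point C \<circ> fst) ` arc_crossings C \<alpha> \<beta>"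
    using z by (meson empty_iff)+
  then obtain x y where "z = point C x" "(x, y) \<in> arc_crossings C \<alpha> \<beta>"
    by (elim imageE) (metis comp_apply prod.collapse)
  note * = this(1) ab ne this(2)
  then have xy: "x \<in> arc_params \<alpha>" "y \<in> arc_params \<beta>" "z = point C y"
    by (auto simp: arc_crossings_def)
  have "proper_arc \<Delta> C \<alpha>" "proper_arc \<Delta> C \<beta>"
    using assms(2) * unfolding tangle_def by auto
  then have lt: "fst x < length C" "fst y < length C" "fst x = fst \<alpha>" "fst y = fst \<beta>"
    using xy by (cases \<alpha>, cases \<beta>, auto)+
  have "on_arc x \<alpha>"
    using xy same_param_refl unfolding on_arc_def by blast
  then have "z \<in> \<Delta>"
    using assms(2) * lt unfolding tangle_def by blast
  moreover have "z \<in> range (C ! fst x)" "z \<in> range (C ! fst y)" "fst x \<noteq> fst y"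
    using * xy(3) lt(3,4) by (metis point_def rangeI)+
  then have "z \<in> mixed_crossings C"
    unfolding mixed_crossings_def using lt(1,2) by blast
  ultimately show "z \<in> mixed_crossings C \<inter> \<Delta>" by simp
qed

text \<open>
  Outside the disc neither diagram runs along the arcs, and there both have the same parametrization.
  So only the mixed crossings inside the disc have to be compared.
\<close>
lemma local_change_mixed_crossings:
  assumes "local_change as D D'"
  obtains \<Delta> where "tangle \<Delta> as (strands D)" "tangle \<Delta> as (strands D')"
    "mixed_crossings (strands D) - \<Delta> = mixed_crossings (strands D') - \<Delta>"
proof -
  define C C' where "C = strands D" and "C' = strands D'"
  obtain \<Delta> where tangles: "tangle \<Delta> as C" "tangle \<Delta> as C'"
    using assms unfolding local_change_def C_def C'_def by blast
  have len: "length C = length C'"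
    and same: "\<And>x. fst x < length C \<Longrightarrow> \<forall>\<alpha>\<in>set as. \<not> on_arc x \<alpha> \<Longrightarrow> point C x = point C' x"
    using assms unfolding local_change_def C_def C'_def by auto
  have ranges: "z \<in> range (C ! i) \<longleftrightarrow> z \<in> range (C' ! i)" if z: "z \<notin> \<Delta>" "i < length C" for z i
  proof -
    have "point C (i, t) = z \<longleftrightarrow> point C' (i, t) = z" for t
      using tangles same[of "(i, t)"] z len unfolding tangle_def by (metis fst_conv)
    then show ?thesis
      unfolding point_def image_iff fst_conv snd_conv by metis
  qed
  have "z \<in> mixed_crossings C \<longleftrightarrow> z \<in> mixed_crossings C'" if "z \<notin> \<Delta>" for z
    unfolding mixed_crossings_def mem_Collect_eq using ranges[OF that] len by metis
  then have "mixed_crossings C - \<Delta> = mixed_crossings C' - \<Delta>"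
    by blast
  then show thesis
    using that tangles unfolding C_def C'_def by blast
qed

lemma local_change_generic:
  assumes "local_change as D D'"
  shows "generic (strands D)" "generic (strands D')"
  using assms by (auto simp: local_change_def link_diagram_def)

lemma mixed_crossing_number_split:
  assumes "generic (strands D)"
  shows "mixed_crossing_number D =
    card (mixed_crossings (strands D) - \<Delta>) + card (mixed_crossings (strands D) \<inter> \<Delta>)"
  unfolding mixed_crossing_number_def
  by (subst card_Un_disjoint[symmetric])
     (use finite_mixed_crossings[OF assms] in \<open>auto intro: arg_cong[where f = card]\<close>)

text \<open>
  Inside the disc there is a single arc, hence a single component, before and after the move.
\<close>
lemma omega1_mixed_crossing_number:
  assumes "omega1 pos ccw D D'"
  shows "mixed_crossing_number D = mixed_crossing_number D'"
proof -
  obtain \<alpha> where lc: "local_change [\<alpha>] D D'"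
    using assms unfolding omega1_def by blast
  obtain \<Delta> where \<Delta>: "tangle \<Delta> [\<alpha>] (strands D)" "tangle \<Delta> [\<alpha>] (strands D')"
    "mixed_crossings (strands D) - \<Delta> = mixed_crossings (strands D') - \<Delta>"
    using local_change_mixed_crossings[OF lc] .
  note gen = local_change_generic[OF lc]
  show ?thesis
    using mixed_crossing_number_split[OF gen(1), of \<Delta>] mixed_crossing_number_split[OF gen(2), of \<Delta>]
      tangle_mixed_crossings[OF gen(1) \<Delta>(1)] tangle_mixed_crossings[OF gen(2) \<Delta>(2)] \<Delta>(3)
    by simp
qed

lemma arc_crossings_swap: "arc_crossings C \<beta> \<alpha> = prod.swap ` arc_crossings C \<alpha> \<beta>"
  by (force simp: arc_crossings_def)

text \<open>
  The arcs are disjoint before the move, so the disc contains no mixed crossing of the first diagram.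
\<close>
lemma omega2_mixed_crossing_number:
  assumes "omega2 parallel pos D D'"
  shows "mixed_crossing_number D \<le> mixed_crossing_number D'"
proof -
  obtain \<alpha> \<beta> where lc: "local_change [\<alpha>, \<beta>] D D'" and none: "arc_crossings (strands D) \<alpha> \<beta> = {}"
    using assms unfolding omega2_def by blast
  obtain \<Delta> where \<Delta>: "tangle \<Delta> [\<alpha>, \<beta>] (strands D)"
    "mixed_crossings (strands D) - \<Delta> = mixed_crossings (strands D') - \<Delta>"
    using local_change_mixed_crossings[OF lc] .
  note gen = local_change_generic[OF lc]
  have "mixed_crossings (strands D) \<inter> \<Delta> = {}"
    unfolding tangle_mixed_crossings[OF gen(1) \<Delta>(1)]
    using none arc_crossings_swap[of "strands D" \<beta> \<alpha>] by auto
  then show ?thesis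
    using mixed_crossing_number_split[OF gen(1), of \<Delta>] mixed_crossing_number_split[OF gen(2), of \<Delta>]
      \<Delta>(2) by simp
qed

text \<open>
  The right-hand side depends only on the components of the three arcs, and these are the same on
  both sides of an \<open>\<Omega>3\<close> move.  The three crossings are distinct points of the plane because a
  coincidence would be a triple point.
\<close>
lemma triangle_mixed_crossings:
  assumes tri: "triangle T M B u v w D q" and gen: "generic (strands D)"
    and tangle: "tangle \<Delta> [T, M, B] (strands D)"
  shows "card (mixed_crossings (strands D) \<inter> \<Delta>) =
    of_bool (fst T \<noteq> fst M) + of_bool (fst T \<noteq> fst B) + of_bool (fst M \<noteq> fst B)"
proof -
  define C where "C = strands D"
  obtain tM mT tB bT mB bM where
    TM: "arc_crossings C T M = {(tM, mT)}" and TB: "arc_crossings C T B = {(tB, bT)}"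
    and MB: "arc_crossings C M B = {(mB, bM)}"
    using tri unfolding triangle_def C_def by blast
  have swap: "arc_crossings C M T = {(mT, tM)}" "arc_crossings C B T = {(bT, tB)}"
    "arc_crossings C B M = {(bM, mB)}"
    using TM TB MB by (simp_all add: arc_crossings_swap[of C M T] arc_crossings_swap[of C B T] arc_crossings_swap[of C B M])
  have mem: "tM \<in> arc_params T" "mT \<in> arc_params M" "tB \<in> arc_params T" "bT \<in> arc_params B"
    "mB \<in> arc_params M" "bM \<in> arc_params B"
    and pt: "point C tM = point C mT" "point C tB = point C bT" "point C mB = point C bM"
    using TM TB MB unfolding arc_crossings_def by blast+
  have proper: "proper_arc \<Delta> C T" "proper_arc \<Delta> C M" "proper_arc \<Delta> C B"
    using tangle unfolding tangle_def C_def by auto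
  have disj: "k = l"
    if "k < 3" "l < 3" "x \<in> arc_params ([T, M, B] ! k)" "y \<in> arc_params ([T, M, B] ! l)"
      "same_param x y" for k l x y
  proof -
    have "on_arc x ([T, M, B] ! k)" "on_arc x ([T, M, B] ! l)"
      using that unfolding on_arc_def by (auto intro: same_param_refl)
    moreover have "length [T, M, B] = 3" by simp
    ultimately show "k = l"
      using tangle that(1,2) unfolding tangle_def by metis
  qed
  have lt: "fst x < length C" if "x \<in> arc_params T \<or> x \<in> arc_params M \<or> x \<in> arc_params B" for x
    using that proper by (cases T, cases M, cases B) auto
  have triple: False
    if "x \<in> arc_params T" "y \<in> arc_params M" "z \<in> arc_params B"
      "point C x = point C y" "point C x = point C z" for x y z
  proof -
    have "double C x y" "double C x z"
      using disj[of 0 1 x y] disj[of 0 2 x z] that lt by (auto simp: double_def)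
    then have "same_param y z"
      using generic_double_unique gen C_def by blast
    then show False
      using disj[of 1 2 y z] that by simp
  qed
  have ne: "point C tM \<noteq> point C tB" "point C tM \<noteq> point C mB" "point C tB \<noteq> point C mB"
    using triple[of tM mT bT] triple[of tM mT bM] triple[of tB mB bT] mem pt by metis+
  have *: "mixed_crossings C \<inter> \<Delta> =
    (if fst T \<noteq> fst M then {point C tM} else {}) \<union> (if fst T \<noteq> fst B then {point C tB} else {}) \<union>
    (if fst M \<noteq> fst B then {point C mB} else {})"
    using tangle_mixed_crossings[OF gen tangle] TM TB MB swap pt
    unfolding C_def by (auto split: if_splits)
  show ?thesis
    using ne unfolding C_def[symmetric] * by auto
qed

lemma omega3_mixed_crossing_number:
  assumes "omega3 u v w D D'"
  shows "mixed_crossing_number D = mixed_crossing_number D'"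
proof -
  obtain T M B where lc: "local_change [T, M, B] D D'"
    and tri: "triangle T M B u v w D (-1)" "triangle T M B u v w D' 1"
    using assms unfolding omega3_def by blast
  obtain \<Delta> where \<Delta>: "tangle \<Delta> [T, M, B] (strands D)" "tangle \<Delta> [T, M, B] (strands D')"
    "mixed_crossings (strands D) - \<Delta> = mixed_crossings (strands D') - \<Delta>"
    using local_change_mixed_crossings[OF lc] .
  note gen = local_change_generic[OF lc]
  show ?thesis
    using mixed_crossing_number_split[OF gen(1), of \<Delta>] mixed_crossing_number_split[OF gen(2), of \<Delta>]
      triangle_mixed_crossings[OF tri(1) gen(1) \<Delta>(1)] triangle_mixed_crossings[OF tri(2) gen(2) \<Delta>(2)] \<Delta>(3)
    by simp
qed

text \<open>
  Among the remaining moves only a backward \<open>\<Omega>2\<close> can change the number, and it goes from the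
  larger diagram to the smaller one.
\<close>
lemma without_forward_omega2_nonincreasing:
  assumes none: "\<And>parallel pos. (Omega2 parallel pos, Forward) \<notin> A"
    and seq: "(\<lambda>E E'. planar_isotopic E E' \<or> (\<exists>m\<in>A. performs m E E'))\<^sup>*\<^sup>* D D'"
  shows "mixed_crossing_number D' \<le> mixed_crossing_number D"
  using seq
proof (induction rule: rtranclp_induct)
  case (step E E')
  have "mixed_crossing_number E' \<le> mixed_crossing_number E" if "performs (m, d) E E'" "(m, d) \<in> A" for m d
    using that none omega1_mixed_crossing_number omega2_mixed_crossing_number omega3_mixed_crossing_number
    by (cases m; cases d) fastforce+
  then show ?case
    using step planar_isotopic_mixed_crossing_number by fastforce
qed simp

lemma without_backward_omega2_nondecreasing:
  assumes none: "\<And>parallel pos. (Omega2 parallel pos, Backward) \<notin> A"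
    and seq: "(\<lambda>E E'. planar_isotopic E E' \<or> (\<exists>m\<in>A. performs m E E'))\<^sup>*\<^sup>* D D'"
  shows "mixed_crossing_number D \<le> mixed_crossing_number D'"
  using seq
proof (induction rule: rtranclp_induct)
  case (step E E')
  have "mixed_crossing_number E \<le> mixed_crossing_number E'" if "performs (m, d) E E'" "(m, d) \<in> A" for m d
    using that none omega1_mixed_crossing_number omega2_mixed_crossing_number omega3_mixed_crossing_number
    by (cases m; cases d) fastforce+
  then show ?case
    using step planar_isotopic_mixed_crossing_number by fastforce
qed simp


section \<open>Directions of projection in general position\<close>

text \<open>
  Projection to the plane of height zero along the direction \<open>(- w, 1)\<close>.
\<close>
definition proj :: "complex \<Rightarrow> space \<Rightarrow> complex" where
  "proj w x = fst x + snd x *\<^sub>R w"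

lemma proj_simps [simp]:
  "proj w (x + y) = proj w x + proj w y" "proj w (x - y) = proj w x - proj w y"
  "proj w (r *\<^sub>R x) = r *\<^sub>R proj w x"
  by (auto simp: proj_def algebra_simps)

lemma continuous_on_proj [continuous_intros]:
  "continuous_on S f \<Longrightarrow> continuous_on S (\<lambda>x. proj w (f x))"
  unfolding proj_def by (intro continuous_intros)

text \<open>
  A vector is projected to zero exactly if it is parallel to \<open>(- w, 1)\<close>, and a nonzero vector has
  at most one such \<open>w\<close>, namely minus its horizontal part divided by its height.  So the directions
  are the image of a null set under a differentiable map between planes.  All bad directions below
  are brought into this form, with \<open>d x\<close> as the difference of two points of the link or as a
  combination of two velocities.
\<close>
lemma negligible_projecting_directions:
  fixes d0 d1 d2 :: space and T :: "(real \<times> real) set"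
  assumes "negligible T"
  defines "d \<equiv> \<lambda>x. d0 + fst x *\<^sub>R d1 + snd x *\<^sub>R d2"
  shows "negligible {w. \<exists>x\<in>T. d x \<noteq> 0 \<and> proj w (d x) = 0}"
proof -
  define S where "S = {x\<in>T. snd (d x) \<noteq> 0}"
  define f where "f x = - (inverse (snd (d x)) *\<^sub>R fst (d x))" for x
  have "negligible S"
    using assms(1) by (rule negligible_subset) (auto simp: S_def)
  moreover have "f differentiable_on S"
  proof -
    have lin: "(fst :: real \<times> real \<Rightarrow> real) differentiable at x within S"
      "(snd :: real \<times> real \<Rightarrow> real) differentiable at x within S" for x
      by (intro bounded_linear_imp_differentiable bounded_linear_fst bounded_linear_snd)+
    have "(\<lambda>x. - (inverse (snd d0 + fst x * snd d1 + snd x * snd d2) *\<^sub>R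
        (fst d0 + fst x *\<^sub>R fst d1 + snd x *\<^sub>R fst d2))) differentiable at x within S"
      if "x \<in> S" for x
      using that
      by (intro differentiable_minus differentiable_scaleR differentiable_inverse differentiable_add
          differentiable_mult differentiable_const lin) (auto simp: S_def d_def)
    then show ?thesis
      unfolding differentiable_on_def f_def d_def by simp
  qed
  ultimately have "negligible (f ` S)"
    by (intro negligible_differentiable_image_negligible) auto
  then show ?thesis
  proof (rule negligible_subset)
    show "{w. \<exists>x\<in>T. d x \<noteq> 0 \<and> proj w (d x) = 0} \<subseteq> f ` S"
    proof
      fix w assume "w \<in> {w. \<exists>x\<in>T. d x \<noteq> 0 \<and> proj w (d x) = 0}"
      then obtain x where x: "x \<in> T" "d x \<noteq> 0" "fst (d x) + snd (d x) *\<^sub>R w = 0"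
        by (auto simp: proj_def)
      then have "snd (d x) \<noteq> 0"
        by (metis add.right_neutral prod.collapse scaleR_zero_left zero_prod_def)
      moreover have "fst (d x) = - (snd (d x) *\<^sub>R w)"
        using x(3) by (simp add: eq_neg_iff_add_eq_0)
      ultimately show "w \<in> f ` S"
        using x by (auto simp: f_def S_def intro!: image_eqI[of _ _ x])
    qed
  qed
qed

lemma cross_eq_0_imp_parallel:
  assumes "cross a b = 0" "a \<noteq> 0"
  obtains r where "b = r *\<^sub>R a"
proof -
  have "b = (if Re a \<noteq> 0 then Re b / Re a else Im b / Im a) *\<^sub>R a"
    using assms by (auto simp: cross_def complex_eq_iff field_simps)
  then show thesis by (rule that)
qed

text \<open>
  If the projections of two linearly independent velocities are linearly dependent, then some
  combination of the velocities, with one of the coefficients equal to \<open>1\<close>, is projected to zero.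
  The pairs of coefficients then lie on two lines.
\<close>
lemma negligible_nontransverse_directions:
  assumes "v \<noteq> 0" "\<nexists>r. v' = r *\<^sub>R v"
  shows "negligible {w. cross (proj w v) (proj w v') = 0}"
proof -
  have "negligible ({x. (1, 0) \<bullet> x = (1::real)} \<union> {x. (0, 1) \<bullet> x = (1::real)} :: (real \<times> real) set)"
    by (intro negligible_Un negligible_hyperplane) auto
  from negligible_projecting_directions[OF this, of 0 v v'] show ?thesis
  proof (rule negligible_subset, intro subsetI CollectI)
    fix w assume "w \<in> {w. cross (proj w v) (proj w v') = 0}"
    then have c: "cross (proj w v) (proj w v') = 0" by simp
    show "\<exists>x\<in>{x. (1, 0) \<bullet> x = 1} \<union> {x. (0, 1) \<bullet> x = 1}.
        0 + fst x *\<^sub>R v + snd x *\<^sub>R v' \<noteq> 0 \<and> proj w (0 + fst x *\<^sub>R v + snd x *\<^sub>R v') = 0"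
    proof (cases "proj w v = 0")
      case True
      then show ?thesis
        using assms(1) by (intro bexI[of _ "(1, 0)"]) auto
    next
      case False
      then obtain r where r: "proj w v' = r *\<^sub>R proj w v"
        using c cross_eq_0_imp_parallel by blast
      have "(- r) *\<^sub>R v + v' \<noteq> 0"
        using assms(2) by (metis add.commute add_eq_0_iff minus_minus scaleR_minus_left)
      then show ?thesis
        using r by (intro bexI[of _ "(- r, 1)"]) (auto simp: proj_def algebra_simps)
    qed
  qed
qed

text \<open>
  Differences of points on two parallel lines depend on one real parameter only.  The case
  \<open>v' = 0\<close>, \<open>r = 0\<close> is that of a point and a line.
\<close>
lemma negligible_parallel_directions:
  assumes "v' = r *\<^sub>R v"
  shows "negligible {w. \<exists>t t'. p + t *\<^sub>R v \<noteq> p' + t' *\<^sub>R v' \<and>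
    proj w (p + t *\<^sub>R v) = proj w (p' + t' *\<^sub>R v')}"
proof -
  have "negligible {x :: real \<times> real. (0, 1) \<bullet> x = 0}"
    by (intro negligible_hyperplane) (auto simp: zero_prod_def)
  from negligible_projecting_directions[OF this, of "p - p'" v 0] show ?thesis
  proof (rule negligible_subset, intro subsetI CollectI)
    fix w assume "w \<in> {w. \<exists>t t'. p + t *\<^sub>R v \<noteq> p' + t' *\<^sub>R v' \<and>
      proj w (p + t *\<^sub>R v) = proj w (p' + t' *\<^sub>R v')}"
    then obtain t t' where *: "p + t *\<^sub>R v \<noteq> p' + t' *\<^sub>R v'"
      "proj w (p + t *\<^sub>R v) = proj w (p' + t' *\<^sub>R v')" by blast
    have eq: "p - p' + (t - t' * r) *\<^sub>R v + 0 *\<^sub>R (0 :: space) = (p + t *\<^sub>R v) - (p' + t' *\<^sub>R v')"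
      unfolding assms by (simp add: algebra_simps)
    show "\<exists>x\<in>{x. (0, 1) \<bullet> x = 0}. p - p' + fst x *\<^sub>R v + snd x *\<^sub>R 0 \<noteq> 0 \<and>
        proj w (p - p' + fst x *\<^sub>R v + snd x *\<^sub>R 0) = 0"
    proof (intro bexI[of _ "(t - t' * r, 0)"])
      show "p - p' + fst (t - t' * r, 0::real) *\<^sub>R v + snd (t - t' * r, 0::real) *\<^sub>R 0 \<noteq> 0 \<and>
        proj w (p - p' + fst (t - t' * r, 0::real) *\<^sub>R v + snd (t - t' * r, 0::real) *\<^sub>R 0) = 0"
        unfolding fst_conv snd_conv eq using * by (metis eq_iff_diff_eq_0 proj_simps(2))
    qed auto
  qed
qed

text \<open>
  If \<open>e \<noteq> 0\<close>, then the zeros lie on the graph of a rational function of the first variable and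
  on the vertical line over its pole; otherwise they lie on a line or there are none.
\<close>
lemma negligible_bilinear_zeros:
  fixes a b c e :: real
  assumes "a \<noteq> 0 \<or> b \<noteq> 0 \<or> c \<noteq> 0 \<or> e \<noteq> 0"
  shows "negligible {x. a + b * fst x + c * snd x + e * (fst x * snd x) = 0}"
proof (cases "e = 0")
  case True
  then have "negligible {x :: real \<times> real. (b, c) \<bullet> x = - a}"
    using assms by (intro negligible_hyperplane) (auto simp: zero_prod_def)
  then show ?thesis
    by (rule negligible_subset) (use True in \<open>auto simp: inner_prod_def\<close>)
next
  case False
  define g where "g x = (fst x, - (a + b * fst x) * inverse (c + e * fst x))" for x :: "real \<times> real"
  define S where "S = {x :: real \<times> real. snd x = 0 \<and> c + e * fst x \<noteq> 0}"
  have "negligible {x :: real \<times> real. (0, 1) \<bullet> x = 0}"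
    by (intro negligible_hyperplane) (auto simp: zero_prod_def)
  then have "negligible S"
    by (rule negligible_subset) (auto simp: S_def inner_prod_def)
  moreover have "g differentiable_on S"
    unfolding differentiable_on_def g_def
  proof
    fix x assume "x \<in> S"
    have lin: "(fst :: real \<times> real \<Rightarrow> real) differentiable at x within S"
      by (intro bounded_linear_imp_differentiable bounded_linear_fst)
    show "(\<lambda>x. (fst x, - (a + b * fst x) * inverse (c + e * fst x))) differentiable at x within S"
      using \<open>x \<in> S\<close>
      by (intro differentiable_Pair differentiable_mult differentiable_minus differentiable_add
          differentiable_inverse differentiable_const lin) (auto simp: S_def)
  qed
  ultimately have "negligible (g ` S)"
    by (intro negligible_differentiable_image_negligible) auto
  moreover have "negligible {x :: real \<times> real. (1, 0) \<bullet> x = - c / e}"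
    by (intro negligible_hyperplane) (auto simp: zero_prod_def)
  ultimately have "negligible (g ` S \<union> {x. (1, 0) \<bullet> x = - c / e})"
    by (rule negligible_Un)
  then show ?thesis
  proof (rule negligible_subset, intro subsetI)
    fix x :: "real \<times> real"
    assume "x \<in> {x. a + b * fst x + c * snd x + e * (fst x * snd x) = 0}"
    then have x: "a + b * fst x + c * snd x + e * (fst x * snd x) = 0" by simp
    show "x \<in> g ` S \<union> {x. (1, 0) \<bullet> x = - c / e}"
    proof (cases "c + e * fst x = 0")
      case True
      then have "fst x = - c / e"
        using False by (simp add: field_simps)
      then show ?thesis by (simp add: inner_prod_def)
    next
      case ne: False
      have "(c + e * fst x) * snd x = - (a + b * fst x)"
        using x by (simp add: algebra_simps)
      then have "snd x = - (a + b * fst x) * inverse (c + e * fst x)"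
        using ne by (simp add: field_simps)
      then have "x = g (fst x, 0)"
        unfolding g_def by (simp add: prod_eq_iff)
      then show ?thesis
        using ne by (auto simp: S_def)
    qed
  qed
qed

text \<open>
  The determinant of three vectors of 3-space.
\<close>
definition det3 :: "space \<Rightarrow> space \<Rightarrow> space \<Rightarrow> real" where
  "det3 x y z = snd x * cross (fst y) (fst z) + snd y * cross (fst z) (fst x) + snd z * cross (fst x) (fst y)"

lemma det3_projecting: "det3 (- w, 1) y z = cross (proj w y) (proj w z)"
  by (simp add: det3_def cross_def proj_def algebra_simps)

text \<open>
  The three-term Pluecker relation for the determinants of \<open>d\<close>, \<open>x\<close>, \<open>y\<close>, \<open>u\<close> with the
  common last vector \<open>z\<close>.
\<close>
lemma det3_Pluecker:
  "det3 d x z * det3 y u z = det3 d y z * det3 x u z - det3 d u z * det3 x y z"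
  unfolding det3_def cross_def by algebra

text \<open>
  Suppose that the points with parameters \<open>s1\<close>, \<open>s2\<close>, \<open>s3\<close> on three lines are
  projected to one point.  Then the vectors from \<open>p3\<close> to the first two points and \<open>v3\<close> are linearly
  dependent, since all of them lie in the plane spanned by \<open>v3\<close> and the direction of projection.
  This is a bilinear equation for \<open>s1\<close> and \<open>s2\<close>.  If it is not trivial, then its solutions form a
  null set, and the direction is determined by \<open>s1\<close> and \<open>s2\<close>.  If all its coefficients vanish, then
  transversality forces the three lines into a common plane; this plane contains the direction of
  projection, so the projected lines coincide, which contradicts transversality again.
\<close>
lemma negligible_triple_directions:
  "negligible {w. \<exists>s1 s2 s3. p1 + s1 *\<^sub>R v1 \<noteq> p2 + s2 *\<^sub>R v2 \<and>
     proj w (p1 + s1 *\<^sub>R v1) = proj w (p2 + s2 *\<^sub>R v2) \<and>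
     proj w (p1 + s1 *\<^sub>R v1) = proj w (p3 + s3 *\<^sub>R v3) \<and>
     cross (proj w v1) (proj w v3) \<noteq> 0 \<and> cross (proj w v2) (proj w v3) \<noteq> 0}"
    (is "negligible ?B")
proof -
  define q1 q2 where "q1 = p1 - p3" and "q2 = p2 - p3"
  define a b c e where "a = det3 q2 q1 v3" and "b = det3 q2 v1 v3" and "c = det3 v2 q1 v3"
    and "e = det3 v2 v1 v3"
  define T where "T = {x. a + b * fst x + c * snd x + e * (fst x * snd x) = 0}"
  have bad: "\<exists>x\<in>T. p1 - p2 + fst x *\<^sub>R v1 + snd x *\<^sub>R (- v2) \<noteq> 0 \<and>
      proj w (p1 - p2 + fst x *\<^sub>R v1 + snd x *\<^sub>R (- v2)) = 0"
    and ne: "a \<noteq> 0 \<or> b \<noteq> 0 \<or> c \<noteq> 0 \<or> e \<noteq> 0"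
    if w: "w \<in> ?B" for w
  proof -
    obtain s1 s2 s3 where n: "p1 + s1 *\<^sub>R v1 \<noteq> p2 + s2 *\<^sub>R v2" 
      and 2: "proj w (p1 + s1 *\<^sub>R v1) = proj w (p2 + s2 *\<^sub>R v2)"
      and 3: "proj w (p1 + s1 *\<^sub>R v1) = proj w (p3 + s3 *\<^sub>R v3)"
      and t13: "cross (proj w v1) (proj w v3) \<noteq> 0" and t23: "cross (proj w v2) (proj w v3) \<noteq> 0"
      using w by blast
    define d where "d = (- w, 1::real)"
    have along: "x = snd x *\<^sub>R d" if "proj w x = 0" for x
      using that by (simp add: proj_def d_def prod_eq_iff eq_neg_iff_add_eq_0)
    obtain r where r: "(p1 + s1 *\<^sub>R v1) - (p2 + s2 *\<^sub>R v2) = r *\<^sub>R d"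
      using along[of "(p1 + s1 *\<^sub>R v1) - (p2 + s2 *\<^sub>R v2)"] 2 by (metis eq_iff_diff_eq_0 proj_simps(2))
    obtain r' where r': "(p1 + s1 *\<^sub>R v1) - (p3 + s3 *\<^sub>R v3) = r' *\<^sub>R d"
      using along[of "(p1 + s1 *\<^sub>R v1) - (p3 + s3 *\<^sub>R v3)"] 3 by (metis eq_iff_diff_eq_0 proj_simps(2))
    have r0: "r \<noteq> 0"
      using n r by auto
    \<comment> \<open>In this form the determinant below has linearly dependent columns.\<close>
    have x1: "q1 + s1 *\<^sub>R v1 = r' *\<^sub>R d + s3 *\<^sub>R v3"
      using r' unfolding q1_def by (simp add: algebra_simps)
    have x2: "q2 + s2 *\<^sub>R v2 = (r' - r) *\<^sub>R d + s3 *\<^sub>R v3"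
      using r r' unfolding q2_def by (simp add: algebra_simps) 
    have "a + b * s1 + c * s2 + e * (s1 * s2) = det3 (q2 + s2 *\<^sub>R v2) (q1 + s1 *\<^sub>R v1) v3"
      unfolding a_def b_def c_def e_def det3_def cross_def by (simp add: algebra_simps)
    also have "\<dots> = 0"
      unfolding x1 x2 det3_def cross_def by (simp add: algebra_simps)
    finally have "(s1, s2) \<in> T"
      by (simp add: T_def)
    moreover have "p1 - p2 + s1 *\<^sub>R v1 + s2 *\<^sub>R (- v2) = (p1 + s1 *\<^sub>R v1) - (p2 + s2 *\<^sub>R v2)"
      by (simp add: algebra_simps)
    moreover have "(p1 + s1 *\<^sub>R v1) - (p2 + s2 *\<^sub>R v2) \<noteq> 0" "proj w ((p1 + s1 *\<^sub>R v1) - (p2 + s2 *\<^sub>R v2)) = 0"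
      using n 2 by (metis eq_iff_diff_eq_0 proj_simps(2))+
    ultimately show "\<exists>x\<in>T. p1 - p2 + fst x *\<^sub>R v1 + snd x *\<^sub>R (- v2) \<noteq> 0 \<and>
        proj w (p1 - p2 + fst x *\<^sub>R v1 + snd x *\<^sub>R (- v2)) = 0"
      by (metis fst_conv snd_conv)
    show "a \<noteq> 0 \<or> b \<noteq> 0 \<or> c \<noteq> 0 \<or> e \<noteq> 0"
    proof (rule ccontr)
      assume "\<not> ?thesis"
      then have 0: "a = 0" "b = 0" "c = 0" "e = 0" by auto
      \<comment> \<open>The vanishing coefficients \<open>b\<close>, \<open>e\<close> put \<open>q2\<close> and \<open>v2\<close> into the plane of \<open>v1\<close> and \<open>v3\<close>.\<close>
      have "det3 d v1 v3 * det3 q2 v2 v3 = det3 d q2 v3 * det3 v1 v2 v3 - det3 d v2 v3 * det3 v1 q2 v3"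
        by (rule det3_Pluecker)
      moreover have "det3 v1 v2 v3 = - e" "det3 v1 q2 v3 = - b"
        unfolding e_def b_def det3_def cross_def by (simp_all add: algebra_simps)
      ultimately have "det3 q2 v2 v3 = 0"
        using 0 t13 det3_projecting[of w v1 v3] by (simp add: d_def)
      moreover have "r * det3 d v2 v3 = - c - s1 * e - det3 q2 v2 v3"
      proof -
        have "r * det3 d v2 v3 = det3 (r *\<^sub>R d) v2 v3"
          unfolding det3_def cross_def by (simp add: algebra_simps)
        also have "r *\<^sub>R d = q1 + s1 *\<^sub>R v1 - (q2 + s2 *\<^sub>R v2)"
          unfolding x1 x2 by (simp add: algebra_simps)
        also have "det3 (q1 + s1 *\<^sub>R v1 - (q2 + s2 *\<^sub>R v2)) v2 v3 = - c - s1 * e - det3 q2 v2 v3"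
          unfolding c_def e_def det3_def cross_def by (simp add: algebra_simps)
        finally show ?thesis .
      qed
      ultimately show False
        using 0 r0 t23 det3_projecting[of w v2 v3] by (simp add: d_def)
    qed
  qed
  show ?thesis
  proof (cases "?B = {}")
    case True
    show ?thesis unfolding True by (rule negligible_empty)
  next
    case False
    then have "negligible T"
      unfolding T_def using ne by (intro negligible_bilinear_zeros) blast
    from negligible_projecting_directions[OF this, of "p1 - p2" v1 "- v2"] show ?thesis
      by (rule negligible_subset) (use bad in blast)
  qed
qed

text \<open>
  Here \<open>\<Lambda>\<close> stands for the lines spanned by the edges of a link, given by a point and a velocity,
  and \<open>V\<close> for the vertices.  The conditions say that no vertex is projected onto another point of
  the link, that crossings are transverse, and that there are no triple points.  They refer to
  whole lines instead of edges, which only makes them stronger.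
\<close>
definition general_direction :: "(space \<times> space) set \<Rightarrow> space set \<Rightarrow> complex \<Rightarrow> bool" where
  "general_direction \<Lambda> V w \<longleftrightarrow>
     (\<forall>q\<in>V. \<forall>(p, v)\<in>\<Lambda>. \<forall>t. q \<noteq> p + t *\<^sub>R v \<longrightarrow> proj w q \<noteq> proj w (p + t *\<^sub>R v)) \<and>
     (\<forall>(p, v)\<in>\<Lambda>. \<forall>(p', v')\<in>\<Lambda>. cross (proj w v) (proj w v') \<noteq> 0 \<or>
        (\<forall>t t'. p + t *\<^sub>R v \<noteq> p' + t' *\<^sub>R v' \<longrightarrow> proj w (p + t *\<^sub>R v) \<noteq> proj w (p' + t' *\<^sub>R v'))) \<and>
     (\<forall>(p1, v1)\<in>\<Lambda>. \<forall>(p2, v2)\<in>\<Lambda>. \<forall>(p3, v3)\<in>\<Lambda>. \<forall>s1 s2 s3.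
        p1 + s1 *\<^sub>R v1 \<noteq> p2 + s2 *\<^sub>R v2 \<and>
        cross (proj w v1) (proj w v3) \<noteq> 0 \<and> cross (proj w v2) (proj w v3) \<noteq> 0 \<longrightarrow>
        \<not> (proj w (p1 + s1 *\<^sub>R v1) = proj w (p2 + s2 *\<^sub>R v2) \<and>
           proj w (p1 + s1 *\<^sub>R v1) = proj w (p3 + s3 *\<^sub>R v3)))"

lemma general_direction_exists:
  assumes "finite \<Lambda>" "finite V" "\<And>p v. (p, v) \<in> \<Lambda> \<Longrightarrow> v \<noteq> 0" "\<epsilon> > 0"
  obtains w where "norm w < \<epsilon>" "general_direction \<Lambda> V w"
proof -
  define B1 where "B1 = (\<lambda>(q, p, v). {w. \<exists>t t'. p + t *\<^sub>R v \<noteq> q + t' *\<^sub>R 0 \<and>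
    proj w (p + t *\<^sub>R v) = proj w (q + t' *\<^sub>R 0)})"
  define B2 where "B2 = (\<lambda>((p, v), p', v'). {w. cross (proj w v) (proj w v') = 0 \<and>
    (\<exists>t t'. p + t *\<^sub>R v \<noteq> p' + t' *\<^sub>R v' \<and> proj w (p + t *\<^sub>R v) = proj w (p' + t' *\<^sub>R v'))})"
  define B3 where "B3 = (\<lambda>((p1, v1), (p2, v2), p3, v3). {w. \<exists>s1 s2 s3. p1 + s1 *\<^sub>R v1 \<noteq> p2 + s2 *\<^sub>R v2 \<and>
     proj w (p1 + s1 *\<^sub>R v1) = proj w (p2 + s2 *\<^sub>R v2) \<and>
     proj w (p1 + s1 *\<^sub>R v1) = proj w (p3 + s3 *\<^sub>R v3) \<and>
     cross (proj w v1) (proj w v3) \<noteq> 0 \<and> cross (proj w v2) (proj w v3) \<noteq> 0})"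
  define B where "B = \<Union>(B1 ` (V \<times> \<Lambda>)) \<union> \<Union>(B2 ` (\<Lambda> \<times> \<Lambda>)) \<union> \<Union>(B3 ` (\<Lambda> \<times> \<Lambda> \<times> \<Lambda>))"
  have 1: "negligible (B1 x)" for x
  proof -
    obtain q p v where "x = (q, p, v)" by (cases x) auto
    then show ?thesis
      unfolding B1_def using negligible_parallel_directions[of 0 0 v p q] by simp
  qed
  have 2: "negligible (B2 x)" if "x \<in> \<Lambda> \<times> \<Lambda>" for x
  proof -
    obtain p v p' v' where x: "x = ((p, v), p', v')" by (cases x) auto
    show ?thesis
    proof (cases "\<exists>r. v' = r *\<^sub>R v")
      case True
      then obtain r where "v' = r *\<^sub>R v" by blast
      from negligible_parallel_directions[OF this] show ?thesis
        by (rule negligible_subset) (auto simp: B2_def x)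
    next
      case False
      moreover have "v \<noteq> 0" using assms(3)[of p v] that x by blast
      ultimately have "negligible {w. cross (proj w v) (proj w v') = 0}"
        by (intro negligible_nontransverse_directions)
      then show ?thesis
        by (rule negligible_subset) (auto simp: B2_def x)
    qed
  qed
  have 3: "negligible (B3 x)" for x
  proof -
    obtain p1 v1 p2 v2 p3 v3 where x: "x = ((p1, v1), (p2, v2), p3, v3)" by (cases x) auto
    show ?thesis
      unfolding x B3_def using negligible_triple_directions[of p1 v1 p2 v2 p3 v3] by simp
  qed
  have "negligible B"
    unfolding B_def using 1 2 3 assms(1,2)
    by (intro negligible_Un negligible_Union finite_imageI finite_cartesian_product) auto
  then have "\<not> ball 0 \<epsilon> \<subseteq> B"
    using open_not_negligible[of "ball (0::complex) \<epsilon>"] negligible_subset assms(4) by auto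
  then obtain w where w: "norm w < \<epsilon>" "w \<notin> B"
    by (metis mem_ball_0 subsetI)
  have g1: "proj w q \<noteq> proj w (p + t *\<^sub>R v)" if "q \<in> V" "(p, v) \<in> \<Lambda>" "q \<noteq> p + t *\<^sub>R v" for q p v t
  proof
    assume "proj w q = proj w (p + t *\<^sub>R v)"
    then have "w \<in> B1 (q, p, v)"
      using that(3) unfolding B1_def by fastforce
    then show False using w that unfolding B_def by blast
  qed
  have g2: "cross (proj w v) (proj w v') \<noteq> 0 \<or>
      (p + t *\<^sub>R v \<noteq> p' + t' *\<^sub>R v' \<longrightarrow> proj w (p + t *\<^sub>R v) \<noteq> proj w (p' + t' *\<^sub>R v'))"
    if "(p, v) \<in> \<Lambda>" "(p', v') \<in> \<Lambda>" for p v p' v' t t'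
  proof -
    have "w \<notin> B2 ((p, v), p', v')"
      using w that unfolding B_def by blast
    then show ?thesis unfolding B2_def prod.case mem_Collect_eq by blast
  qed
  have g3: "\<not> (proj w (p1 + s1 *\<^sub>R v1) = proj w (p2 + s2 *\<^sub>R v2) \<and>
           proj w (p1 + s1 *\<^sub>R v1) = proj w (p3 + s3 *\<^sub>R v3))"
    if "(p1, v1) \<in> \<Lambda>" "(p2, v2) \<in> \<Lambda>" "(p3, v3) \<in> \<Lambda>" "p1 + s1 *\<^sub>R v1 \<noteq> p2 + s2 *\<^sub>R v2"
      "cross (proj w v1) (proj w v3) \<noteq> 0" "cross (proj w v2) (proj w v3) \<noteq> 0"
    for p1 v1 p2 v2 p3 v3 s1 s2 s3
  proof -
    have "w \<notin> B3 ((p1, v1), (p2, v2), p3, v3)"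
      using w that(1-3) unfolding B_def by blast
    then show ?thesis unfolding B3_def prod.case mem_Collect_eq using that(4-6) by blast
  qed
  have "general_direction \<Lambda> V w"
    unfolding general_direction_def using g1 g2 g3 by blast
  then show thesis using w that by blast
qed

lemma general_directionD:
  assumes "general_direction \<Lambda> V w"
  shows "q \<in> V \<Longrightarrow> (p, v) \<in> \<Lambda> \<Longrightarrow> proj w q = proj w (p + t *\<^sub>R v) \<Longrightarrow> q = p + t *\<^sub>R v"
    and "(p, v) \<in> \<Lambda> \<Longrightarrow> (p', v') \<in> \<Lambda> \<Longrightarrow> proj w (p + t *\<^sub>R v) = proj w (p' + t' *\<^sub>R v') \<Longrightarrow>
      p + t *\<^sub>R v \<noteq> p' + t' *\<^sub>R v' \<Longrightarrow> cross (proj w v) (proj w v') \<noteq> 0"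
    and "(p1, v1) \<in> \<Lambda> \<Longrightarrow> (p2, v2) \<in> \<Lambda> \<Longrightarrow> (p3, v3) \<in> \<Lambda> \<Longrightarrow>
      cross (proj w v1) (proj w v3) \<noteq> 0 \<Longrightarrow> cross (proj w v2) (proj w v3) \<noteq> 0 \<Longrightarrow>
      proj w (p1 + s1 *\<^sub>R v1) = proj w (p2 + s2 *\<^sub>R v2) \<Longrightarrow>
      proj w (p1 + s1 *\<^sub>R v1) = proj w (p3 + s3 *\<^sub>R v3) \<Longrightarrow> p1 + s1 *\<^sub>R v1 = p2 + s2 *\<^sub>R v2"
  using assms unfolding general_direction_def by blast+


section \<open>Generic projections of polygonal links\<close>

fun is_edge :: "(real \<Rightarrow> 'a::real_vector) \<Rightarrow> real \<times> real \<times> 'a \<times> 'a \<Rightarrow> bool" where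
  "is_edge c (a, b, p, v) \<longleftrightarrow> 0 \<le> a \<and> a < b \<and> b \<le> 1 \<and> (\<forall>t\<in>{a..b}. c t = p + t *\<^sub>R v)"

text \<open>
  Cut \<open>[0, 1]\<close> at the exceptional points; the edges belong to pairs of consecutive cutting points.
\<close>
lemma polygonal_edges:
  assumes "polygonal c"
  obtains F where "finite F" "\<And>e. e \<in> F \<Longrightarrow> is_edge c e"
    "\<And>t. 0 \<le> t \<Longrightarrow> t < 1 \<Longrightarrow> \<exists>a b p v. (a, b, p, v) \<in> F \<and> a \<le> t \<and> t < b"
proof -
  obtain S where S: "finite S" and lin: "\<And>a b. 0 \<le> a \<Longrightarrow> a < b \<Longrightarrow> b \<le> 1 \<Longrightarrow> {a<..<b} \<inter> S = {} \<Longrightarrow>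
      \<exists>p v. \<forall>t\<in>{a..b}. c t = p + t *\<^sub>R v"
    using assms unfolding polygonal_def by blast
  define R where "R = insert 0 (insert 1 (S \<inter> {0..1}))"
  have R: "finite R" "0 \<in> R" "1 \<in> R" "R \<subseteq> {0..1}"
    using S by (auto simp: R_def)
  define next_point where "next_point a = Min {s \<in> R. a < s}" for a
  have nextp: "next_point a \<in> R" "a < next_point a" "{a<..<next_point a} \<inter> R = {}" if "a < 1" for a
  proof -
    have fin: "finite {s \<in> R. a < s}" and "{s \<in> R. a < s} \<noteq> {}"
      using R that by auto
    then have "next_point a \<in> {s \<in> R. a < s}"
      unfolding next_point_def by (rule Min_in)
    then show "next_point a \<in> R" "a < next_point a" by auto
    show "{a<..<next_point a} \<inter> R = {}"
      using Min_le[OF fin] unfolding next_point_def by fastforce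
  qed
  have "\<forall>a\<in>R - {1}. \<exists>e. is_edge c e \<and> fst e = a \<and> fst (snd e) = next_point a"
  proof
    fix a assume a: "a \<in> R - {1}"
    then have bounds: "0 \<le> a" "a < 1" using R by force+
    have b: "next_point a \<le> 1" "a < next_point a" using nextp[OF bounds(2)] R by auto
    have "{a<..<next_point a} \<inter> S \<subseteq> {a<..<next_point a} \<inter> R"
      using bounds b by (auto simp: R_def)
    then have "{a<..<next_point a} \<inter> S = {}"
      using nextp[OF bounds(2)] by blast
    then obtain p v where "\<forall>t\<in>{a..next_point a}. c t = p + t *\<^sub>R v"
      using lin bounds b by blast
    then show "\<exists>e. is_edge c e \<and> fst e = a \<and> fst (snd e) = next_point a"
      using bounds b by (intro exI[of _ "(a, next_point a, p, v)"]) auto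
  qed
  then obtain g where g: "\<And>a. a \<in> R - {1} \<Longrightarrow> is_edge c (g a) \<and> fst (g a) = a \<and> fst (snd (g a)) = next_point a"
    by metis
  show thesis
  proof (rule that[of "g ` (R - {1})"])
    fix t :: real assume t: "0 \<le> t" "t < 1"
    define a where "a = Max {s \<in> R. s \<le> t}"
    have fin: "finite {s \<in> R. s \<le> t}" and "{s \<in> R. s \<le> t} \<noteq> {}"
      using R t by auto
    then have "a \<in> {s \<in> R. s \<le> t}"
      unfolding a_def by (rule Max_in)
    then have a: "a \<in> R - {1}" "a \<le> t" "a < 1" using t by auto
    have "t < next_point a"
    proof (rule ccontr)
      assume "\<not> t < next_point a"
      then have "next_point a \<le> a"
        unfolding a_def using nextp(1)[OF a(3)] fin by (intro Max_ge) (auto simp: a_def)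
      then show False using nextp(2)[OF a(3)] by simp
    qed
    moreover have "g a = (a, next_point a, fst (snd (snd (g a))), snd (snd (snd (g a))))"
      using g[OF a(1)] by (simp add: prod_eq_iff)
    ultimately show "\<exists>a b p v. (a, b, p, v) \<in> g ` (R - {1}) \<and> a \<le> t \<and> t < b"
      using a by (metis imageI)
  next
    show "is_edge c e" if "e \<in> g ` (R - {1})" for e
      using that g by blast
  qed (use R in auto)
qed

lemma link_point_inject:
  assumes "link P" "fst x < length P" "fst y < length P" "\<not> same_param x y"
  shows "point P x \<noteq> point P y"
  using assms unfolding link_def double_def by blast

text \<open>
  On an edge without velocity the curve would stand still, but components of links are injective up
  to the period.  The midpoint is used because the end points may differ by a full period.
\<close>
lemma edge_velocity_nonzero:
  assumes "link P" "i < length P" "is_edge (P ! i) (a, b, p, v)"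
  shows "v \<noteq> 0"
proof
  assume "v = 0"
  then have "(P ! i) a = (P ! i) ((a + b) / 2)" using assms(3) by auto
  moreover have "a - (a + b) / 2 \<notin> \<int>"
  proof
    assume "a - (a + b) / 2 \<in> \<int>"
    then obtain k where k: "a - (a + b) / 2 = of_int k"
      by (auto elim: Ints_cases)
    have "a - (a + b) / 2 < 0" "a - (a + b) / 2 > - 1"
      using assms(3) by (auto simp: field_simps)
    then have "of_int k < (of_int 0 :: real)" "of_int (- 1) < (of_int k :: real)" unfolding k by auto
    then show False unfolding of_int_less_iff by linarith
  qed
  ultimately show False
    using link_point_inject[OF assms(1), of "(i, a)" "(i, (a + b) / 2)"] assms(2)
    by (auto simp: point_def same_param_def)
qed

lemma nonconstant_edge_exists:
  assumes "link P" "\<forall>c\<in>set P. polygonal c" "i < length P"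
  obtains a b p v where "is_edge (P ! i) (a, b, p, v)" "v \<noteq> 0"
proof -
  have "polygonal (P ! i)" using assms(2,3) by simp
  then obtain F where F: "\<And>e. e \<in> F \<Longrightarrow> is_edge (P ! i) e"
    "\<And>t. 0 \<le> t \<Longrightarrow> t < 1 \<Longrightarrow> \<exists>a b p v. (a, b, p, v) \<in> F \<and> a \<le> t \<and> t < b"
    using polygonal_edges by blast
  obtain a b p v where "(a, b, p, v) \<in> F"
    using F(2)[of 0] by auto
  then have "is_edge (P ! i) (a, b, p, v)" by (rule F(1))
  then show thesis
    using that edge_velocity_nonzero[OF assms(1,3)] by blast
qed

lemma subsingleton_finite:
  assumes "\<And>x y. x \<in> A \<Longrightarrow> y \<in> A \<Longrightarrow> x = y"
  shows "finite A"
  using assms by (metis finite.simps finite_subset insertCI subsetI)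

lemma transverse_lines_meet_once:
  fixes p v p' v' :: complex
  assumes "cross v v' \<noteq> 0" "p + t *\<^sub>R v = p' + t' *\<^sub>R v'" "p + s *\<^sub>R v = p' + s' *\<^sub>R v'"
  shows "t = s"
proof -
  have "(t - s) *\<^sub>R v = (p + t *\<^sub>R v) - (p + s *\<^sub>R v)"
    by (simp add: algebra_simps)
  also have "\<dots> = (t' - s') *\<^sub>R v'"
    unfolding assms(2,3) by (simp add: algebra_simps)
  finally have "(t - s) *\<^sub>R v = (t' - s') *\<^sub>R v'" .
  then have "cross ((t - s) *\<^sub>R v) v' = cross ((t' - s') *\<^sub>R v') v'" by simp
  then have "(t - s) * cross v v' = 0"
    by (simp add: cross_def algebra_simps)
  then show ?thesis using assms(1) by simp
qed

lemma double_proj: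
  "double (map (\<lambda>c. proj w \<circ> c) P) x y \<longleftrightarrow> fst x < length P \<and> fst y < length P \<and>
     proj w (point P x) = proj w (point P y) \<and> \<not> same_param x y"
  by (auto simp: double_def point_def)

text \<open>
  At a double point of the projection both strands pass through interior points of edges, since no vertex is
  projected onto another point.  There the projection is affine, so transversality can be read off from
  the velocities of the edges.  Two lines contribute at most one double point, hence there are only
  finitely many.
\<close>
lemma polygonal_generic_projection:
  assumes "link P" "\<forall>c\<in>set P. polygonal c" "\<epsilon> > 0"
  obtains w where "norm w < \<epsilon>" "generic (map (\<lambda>c. proj w \<circ> c) P)"
proof -
  define n where "n = length P"
  have closed: "\<And>c. c \<in> set P \<Longrightarrow> closed_curve c"
    using assms(1) by (auto simp: link_def)
  have "\<forall>i\<in>{..<n}. \<exists>F. finite F \<and> (\<forall>e\<in>F. is_edge (P ! i) e) \<and>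
      (\<forall>t. 0 \<le> t \<and> t < 1 \<longrightarrow> (\<exists>a b p v. (a, b, p, v) \<in> F \<and> a \<le> t \<and> t < b))"
  proof
    fix i assume "i \<in> {..<n}"
    then have "polygonal (P ! i)" using assms(2) n_def by auto
    then show "\<exists>F. finite F \<and> (\<forall>e\<in>F. is_edge (P ! i) e) \<and>
      (\<forall>t. 0 \<le> t \<and> t < 1 \<longrightarrow> (\<exists>a b p v. (a, b, p, v) \<in> F \<and> a \<le> t \<and> t < b))"
      using polygonal_edges by (smt (verit))
  qed
  then obtain F where F: "\<forall>i\<in>{..<n}. finite (F i) \<and> (\<forall>e\<in>F i. is_edge (P ! i) e) \<and>
      (\<forall>t. 0 \<le> t \<and> t < 1 \<longrightarrow> (\<exists>a b p v. (a, b, p, v) \<in> F i \<and> a \<le> t \<and> t < b))"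
    by (auto dest!: bchoice)
  then have F_fin: "\<And>i. i < n \<Longrightarrow> finite (F i)" and F_edge: "\<And>i e. i < n \<Longrightarrow> e \<in> F i \<Longrightarrow> is_edge (P ! i) e"
    and F_cover: "\<And>i t. i < n \<Longrightarrow> 0 \<le> t \<Longrightarrow> t < 1 \<Longrightarrow> \<exists>a b p v. (a, b, p, v) \<in> F i \<and> a \<le> t \<and> t < b"
    by blast+
  define \<Lambda> where "\<Lambda> = (\<Union>i<n. snd ` snd ` F i)"
  define V where "V = (\<Union>i<n. (\<lambda>e. (P ! i) (fst e)) ` F i)"
  have fin: "finite \<Lambda>" "finite V"
    using F_fin by (auto simp: \<Lambda>_def V_def)
  have nz: "v \<noteq> 0" if "(p, v) \<in> \<Lambda>" for p v
  proof -
    from that obtain i a b where "i < n" "(a, b, p, v) \<in> F i"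
      by (auto simp: \<Lambda>_def image_iff)
    then show ?thesis
      using edge_velocity_nonzero[OF assms(1)] F_edge n_def by blast
  qed
  obtain w where w: "norm w < \<epsilon>" "general_direction \<Lambda> V w"
    using general_direction_exists[OF fin _ assms(3)] nz by blast
  define C where "C = map (\<lambda>c. proj w \<circ> c) P"
  have pt: "point C x = proj w (point P x)" if "fst x < n" for x
    using that by (simp add: C_def n_def point_def)
  \<comment> \<open>At the start of an edge the curve need not be differentiable; crossings will turn out to avoid these points.\<close>
  have edge_at: "\<exists>p v t. (p, v) \<in> \<Lambda> \<and> point P x = p + t *\<^sub>R v \<and>
      (point P x \<in> V \<or> ((C ! fst x) has_vector_derivative proj w v) (at (snd x)))"
    if "fst x < n" for x
  proof -
    obtain i s where x: "x = (i, s)" by (cases x) auto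
    then have i: "i < n" using that by simp
    define m :: real where "m = of_int \<lfloor>s\<rfloor>"
    have per: "(P ! i) r = (P ! i) (r - m)" for r
      using closed_curve_shift[of "P ! i" r "r - m"] closed i by (auto simp: n_def m_def)
    \<comment> \<open>The edges only describe the curve on \<open>[0, 1)\<close>, so the time is reduced by its integer part.\<close>
    have "0 \<le> s - m" "s - m < 1"
      unfolding m_def by linarith+
    then obtain a b p v where e: "(a, b, p, v) \<in> F i" "a \<le> s - m" "s - m < b"
      using F_cover[OF i] by blast
    then have lin: "\<And>t. a \<le> t \<Longrightarrow> t \<le> b \<Longrightarrow> (P ! i) t = p + t *\<^sub>R v"
      using F_edge[OF i e(1)] by simp
    have "(p, v) \<in> \<Lambda>"
      using e i by (force simp: \<Lambda>_def)
    moreover have "point P x = p + (s - m) *\<^sub>R v"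
      using lin[of "s - m"] e per[of s] by (simp add: x point_def)
    moreover have "point P x \<in> V \<or> ((C ! fst x) has_vector_derivative proj w v) (at (snd x))"
    proof (cases "a = s - m")
      case True
      then have "point P x = (P ! i) (fst (a, b, p, v))"
        using per[of s] by (simp add: x point_def)
      then show ?thesis
        using e(1) i unfolding V_def by blast
    next
      case False
      have "((\<lambda>r. proj w p + (r - m) *\<^sub>R proj w v) has_vector_derivative proj w v) (at s)"
        by (auto intro!: derivative_eq_intros)
      then have "((C ! i) has_vector_derivative proj w v) (at s)"
      proof (rule has_vector_derivative_transform_within_open)
        show "open {a + m<..<b + m}" by simp
        show "s \<in> {a + m<..<b + m}" using False e by auto
        show "proj w p + (r - m) *\<^sub>R proj w v = (C ! i) r" if "r \<in> {a + m<..<b + m}" for r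
          using that lin[of "r - m"] per[of r] i by (simp add: C_def n_def)
      qed
      then show ?thesis by (simp add: x)
    qed
    ultimately show ?thesis by blast
  qed
  have vertex_free: "point P x \<notin> V" if d: "double C x y" for x y
  proof
    assume V: "point P x \<in> V"
    have xy: "fst x < n" "fst y < n" "proj w (point P x) = proj w (point P y)" "point P x \<noteq> point P y"
      using d link_point_inject[OF assms(1)] unfolding C_def double_proj n_def by auto
    obtain p v t where "(p, v) \<in> \<Lambda>" "point P y = p + t *\<^sub>R v" using edge_at[OF xy(2)] by blast
    then show False
      using general_directionD(1)[OF w(2) V] xy by metis
  qed
  have sym: "double C x y \<Longrightarrow> double C y x" for x y
    unfolding double_def using same_param_sym by metis
  have crossing: "\<exists>p v t p' v' t'. (p, v) \<in> \<Lambda> \<and> (p', v') \<in> \<Lambda> \<and>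
      point P x = p + t *\<^sub>R v \<and> point P y = p' + t' *\<^sub>R v' \<and>
      ((C ! fst x) has_vector_derivative proj w v) (at (snd x)) \<and>
      ((C ! fst y) has_vector_derivative proj w v') (at (snd y)) \<and>
      cross (proj w v) (proj w v') \<noteq> 0 \<and> point P x \<noteq> point P y"
    if d: "double C x y" for x y
  proof -
    have xy: "fst x < n" "fst y < n" "proj w (point P x) = proj w (point P y)" "point P x \<noteq> point P y"
      using d link_point_inject[OF assms(1)] unfolding C_def double_proj n_def by auto
    obtain p v t where 1: "(p, v) \<in> \<Lambda>" "point P x = p + t *\<^sub>R v"
      "((C ! fst x) has_vector_derivative proj w v) (at (snd x))"
      using edge_at[OF xy(1)] vertex_free[OF d] by blast
    obtain p' v' t' where 2: "(p', v') \<in> \<Lambda>" "point P y = p' + t' *\<^sub>R v'"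
      "((C ! fst y) has_vector_derivative proj w v') (at (snd y))"
      using edge_at[OF xy(2)] vertex_free[OF sym[OF d]] by blast
    have "cross (proj w v) (proj w v') \<noteq> 0"
      using general_directionD(2)[OF w(2) 1(1) 2(1)] xy 1(2) 2(2) by metis
    then show ?thesis using 1 2 xy(4) by blast
  qed
  have "generic C"
    unfolding generic_def
  proof (intro conjI allI impI ballI)
    fix c assume "c \<in> set C"
    then show "closed_curve c"
      using closed unfolding C_def closed_curve_def
      by (fastforce intro!: continuous_on_proj simp: o_def)
  next
    define X where "X = (\<lambda>((p, v), (p', v')). {z. cross (proj w v) (proj w v') \<noteq> 0 \<and>
      (\<exists>t t'. z = proj w p + t *\<^sub>R proj w v \<and> z = proj w p' + t' *\<^sub>R proj w v')})"
    have "finite (X l)" for l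
    proof -
      obtain p v p' v' where l: "l = ((p, v), (p', v'))" by (cases l) auto
      show ?thesis
        unfolding l X_def using transverse_lines_meet_once[of "proj w v" "proj w v'" "proj w p" _ "proj w p'"]
        by (intro subsingleton_finite) fastforce
    qed
    then have "finite (\<Union>l\<in>\<Lambda> \<times> \<Lambda>. X l)"
      using fin by auto
    moreover have "{point C x |x y. double C x y} \<subseteq> (\<Union>l\<in>\<Lambda> \<times> \<Lambda>. X l)"
    proof
      fix z assume "z \<in> {point C x |x y. double C x y}"
      then obtain x y where z: "z = point C x" "double C x y" by blast
      then have xy: "fst x < n" "proj w (point P x) = proj w (point P y)"
        unfolding C_def double_proj n_def by auto
      obtain p v t p' v' t' where l: "(p, v) \<in> \<Lambda>" "(p', v') \<in> \<Lambda>"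
        "point P x = p + t *\<^sub>R v" "point P y = p' + t' *\<^sub>R v'" "cross (proj w v) (proj w v') \<noteq> 0"
        using crossing[OF z(2)] by blast
      have "z = proj w p + t *\<^sub>R proj w v" "z = proj w p' + t' *\<^sub>R proj w v'"
        using l z(1) pt xy by (metis proj_simps(1,3))+
      then have "z \<in> X ((p, v), (p', v'))"
        using l(5) unfolding X_def prod.case mem_Collect_eq by blast
      then show "z \<in> (\<Union>l\<in>\<Lambda> \<times> \<Lambda>. X l)"
        using l(1,2) by blast
    qed
    ultimately show "finite {point C x |x y. double C x y}"
      by (rule rev_finite_subset)
  next
    fix x y z assume d: "double C x y \<and> double C x z"
    show "same_param y z"
    proof (rule ccontr)
      assume "\<not> same_param y z"
      then have yz: "double C y z"
        using d unfolding double_def by metis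
      have n: "fst x < n" "fst y < n" "fst z < n" 
        and eq: "proj w (point P x) = proj w (point P y)" "proj w (point P x) = proj w (point P z)"
        using d unfolding C_def double_proj n_def by auto
      obtain p1 v1 t1 p3 v3 t3 where 13: "(p1, v1) \<in> \<Lambda>" "(p3, v3) \<in> \<Lambda>" "point P x = p1 + t1 *\<^sub>R v1"
        "point P z = p3 + t3 *\<^sub>R v3" "cross (proj w v1) (proj w v3) \<noteq> 0"
        "((C ! fst z) has_vector_derivative proj w v3) (at (snd z))"
        using d crossing by meson
      obtain p2 v2 t2 p4 v4 where 24: "(p2, v2) \<in> \<Lambda>" "point P y = p2 + t2 *\<^sub>R v2"
        "cross (proj w v2) (proj w v4) \<noteq> 0" "((C ! fst z) has_vector_derivative proj w v4) (at (snd z))"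
        using yz crossing by meson
      have "proj w v4 = proj w v3"
        using 13(6) 24(4) by (metis vector_derivative_at)
      then have "cross (proj w v2) (proj w v3) \<noteq> 0" using 24(3) by simp
      moreover have "point P x \<noteq> point P y"
        using d crossing by meson
      ultimately show False
        using general_directionD(3)[OF w(2) 13(1) 24(1) 13(2,5)] 13(3,4) 24(2) eq by metis
    qed
  next
    fix x y assume d: "double C x y"
    then obtain v v' where *: "((C ! fst x) has_vector_derivative v) (at (snd x))"
      "((C ! fst y) has_vector_derivative v') (at (snd y))" "cross v v' \<noteq> 0"
      using crossing by meson
    show "C ! fst x differentiable at (snd x)" "C ! fst y differentiable at (snd y)"
      using * by (auto intro: differentiableI_vector)
    show "cross (velocity C x) (velocity C y) \<noteq> 0"
      using * by (simp add: velocity_def vector_derivative_at)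
  qed
  then show thesis
    using w(1) that unfolding C_def by blast
qed


section \<open>Ambient isotopies of links\<close>

lemma ambient_isotopy_compose:
  assumes "ambient_isotopy H" "ambient_isotopy H'"
  shows "ambient_isotopy (\<lambda>t. H' t \<circ> H t)"
  unfolding ambient_isotopy_def
proof (intro conjI ballI)
  have "continuous_on ({0..1} \<times> UNIV) (\<lambda>x. H (fst x) (snd x))" 
    and H': "continuous_on ({0..1} \<times> UNIV) (\<lambda>x. H' (fst x) (snd x))"
    using assms by (auto simp: ambient_isotopy_def case_prod_unfold)
  then have "continuous_on ({0..1} \<times> UNIV) (\<lambda>x. (fst x, H (fst x) (snd x)))"
    by (intro continuous_intros)
  from continuous_on_compose2[OF H' this]
  show "continuous_on ({0..1} \<times> UNIV) (\<lambda>(t, x). (H' t \<circ> H t) x)"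
    unfolding case_prod_unfold comp_apply fst_conv snd_conv by (rule meta_mp) auto
next
  fix t :: real assume "t \<in> {0..1}"
  then obtain G G' where "homeomorphism UNIV UNIV (H t) G" "homeomorphism UNIV UNIV (H' t) G'"
    using assms unfolding ambient_isotopy_def by blast
  then show "\<exists>G. homeomorphism UNIV UNIV (H' t \<circ> H t) G"
    using homeomorphism_compose by blast
qed (use assms in \<open>auto simp: ambient_isotopy_def\<close>)

lemma ambient_isotopy_continuous:
  assumes "ambient_isotopy H" 
  shows "continuous_on UNIV (H 1)"
proof -
  obtain G where "homeomorphism UNIV UNIV (H 1) G"
    using assms unfolding ambient_isotopy_def by force
  then show ?thesis
    by (simp add: homeomorphism_def)
qed

lemma link_deform:
  assumes "link K" "inj h" "continuous_on UNIV h"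
  shows "link (map ((\<circ>) h) K)"
  unfolding link_def
proof (intro conjI ballI allI)
  fix c assume "c \<in> set (map ((\<circ>) h) K)"
  then obtain c' where c': "c' \<in> set K" "c = h \<circ> c'" by auto
  then have "closed_curve c'" using assms(1) by (auto simp: link_def)
  then show "closed_curve c"
    using c' assms(3) continuous_on_compose2[OF assms(3), of UNIV c']
    unfolding closed_curve_def o_def by auto
next
  fix x y
  have "double (map ((\<circ>) h) K) x y \<Longrightarrow> double K x y"
    using assms(2) by (auto simp: double_def point_def inj_eq)
  then show "\<not> double (map ((\<circ>) h) K) x y"
    using assms(1) unfolding link_def by blast
qed

text \<open>
  Deforming a link by an ambient isotopy does not change its isotopy class; the two ambient isotopies
  are composed at each time.
\<close>
lemma isotopic_deform:
  assumes "isotopic L K" "ambient_isotopy H"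
  shows "isotopic L (map ((\<circ>) (H 1)) K)"
proof -
  obtain H0 \<sigma> f where H0: "ambient_isotopy H0" and c: "carries (H0 1) \<sigma> f L K"
    and links: "link L" "link K"
    using assms(1) unfolding isotopic_def by blast
  have "carries (H 1 \<circ> H0 1) \<sigma> f L (map ((\<circ>) (H 1)) K)"
  proof -
    have "\<sigma> i < length K" if "i < length K" for i
      using c that by (auto simp: carries_def bij_betw_def)
    then show ?thesis
      using c unfolding carries_def by (elim conjE) simp
  qed
  then show ?thesis
    unfolding isotopic_def
    using links ambient_isotopy_compose[OF H0 assms(2)]
      link_deform[OF links(2) ambient_isotopy_inj[OF assms(2)] ambient_isotopy_continuous[OF assms(2)]]
    by blast
qed

text \<open>
  Each horizontal plane is translated, by an amount that depends on its height.
\<close>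
definition shear :: "(real \<Rightarrow> complex) \<Rightarrow> space \<Rightarrow> space" where
  "shear \<phi> x = (fst x + \<phi> (snd x), snd x)"

lemma ambient_isotopy_shear:
  assumes "continuous_on UNIV \<phi>"
  shows "ambient_isotopy (\<lambda>t. shear (\<lambda>h. t *\<^sub>R \<phi> h))"
proof -
  have cont: "continuous_on UNIV (shear (\<lambda>h. t *\<^sub>R \<phi> h))" for t
    unfolding shear_def
    by (intro continuous_intros continuous_on_compose2[OF assms]) auto
  have "homeomorphism UNIV UNIV (shear (\<lambda>h. t *\<^sub>R \<phi> h)) (shear (\<lambda>h. (- t) *\<^sub>R \<phi> h))" for t
    by (rule homeomorphismI) (use cont[of t] cont[of "- t"] in \<open>auto simp: shear_def\<close>)
  moreover have "continuous_on ({0..1} \<times> UNIV) (\<lambda>(t, x). shear (\<lambda>h. t *\<^sub>R \<phi> h) x)"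
    unfolding shear_def case_prod_unfold
    by (intro continuous_intros continuous_on_compose2[OF assms]) auto
  moreover have "shear (\<lambda>h. 0 *\<^sub>R \<phi> h) = id"
    by (simp add: shear_def fun_eq_iff)
  ultimately show ?thesis
    unfolding ambient_isotopy_def by blast
qed

lemma isotopic_shear:
  assumes "isotopic L K" "continuous_on UNIV \<phi>"
  shows "isotopic L (map ((\<circ>) (shear \<phi>)) K)"
  using isotopic_deform[OF assms(1) ambient_isotopy_shear[OF assms(2)]] by simp

text \<open>
  The heights are changed by a linear function of the horizontal coordinates.
\<close>
definition tilt :: "complex \<Rightarrow> space \<Rightarrow> space" where
  "tilt u x = (fst x, snd x + u \<bullet> fst x)"

lemma isotopic_tilt:
  assumes "isotopic L K"
  shows "isotopic L (map ((\<circ>) (tilt u)) K)"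
proof -
  have cont: "continuous_on UNIV (tilt (t *\<^sub>R u))" for t
    unfolding tilt_def by (intro continuous_intros)
  have "homeomorphism UNIV UNIV (tilt (t *\<^sub>R u)) (tilt ((- t) *\<^sub>R u))" for t
    by (rule homeomorphismI) (use cont[of t] cont[of "- t"] in \<open>auto simp: tilt_def\<close>)
  moreover have "continuous_on ({0..1} \<times> UNIV) (\<lambda>(t, x). tilt (t *\<^sub>R u) x)"
    unfolding tilt_def case_prod_unfold by (intro continuous_intros)
  moreover have "tilt (0 *\<^sub>R u) = id"
    by (simp add: tilt_def fun_eq_iff)
  ultimately have "ambient_isotopy (\<lambda>t. tilt (t *\<^sub>R u))"
    unfolding ambient_isotopy_def by blast
  from isotopic_deform[OF assms this] show ?thesis by simp
qed


section \<open>Diagrams of polygonal links\<close>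

definition projection_diagram :: "space curves \<Rightarrow> diagram" where
  "projection_diagram K = (let C = map (\<lambda>c. fst \<circ> c) K in
     \<lparr>strands = C, over = (\<lambda>x. \<exists>y. double C x y \<and> snd (point K x) > snd (point K y))\<rparr>)"

text \<open>
  By genericity the other strand at a crossing is unique up to the period, so comparing with some
  strand there is the same as comparing with any of them; the heights differ since the link has
  no double points.
\<close>
lemma diagram_of_projection:
  assumes "isotopic L K" and gen: "generic (map (\<lambda>c. fst \<circ> c) K)"
  shows "diagram_of (projection_diagram K) L"
proof -
  define C where "C = map (\<lambda>c. fst \<circ> c) K"
  define D where "D = projection_diagram K"
  have D: "strands D = C" "over D x \<longleftrightarrow> (\<exists>y. double C x y \<and> snd (point K x) > snd (point K y))" for x
    by (simp_all add: D_def projection_diagram_def C_def Let_def)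
  have link: "link K" and closed: "\<forall>c\<in>set K. closed_curve c"
    using assms(1) by (auto simp: isotopic_def link_def)
  have len: "length C = length K" by (simp add: C_def)
  have genC: "\<forall>c\<in>set C. closed_curve c" "\<And>x y z. double C x y \<Longrightarrow> double C x z \<Longrightarrow> same_param y z"
    using gen unfolding C_def generic_def by blast+
  have height: "snd (point K y) = snd (point K z)" if "fst y < length K" "same_param y z" for y z
    using point_same_param[OF closed] that by simp
  have overD: "over D x \<longleftrightarrow> snd (point K x) > snd (point K y)" if d: "double C x y" for x y
  proof -
    have "snd (point K y) = snd (point K z)" if "double C x z" for z
      using genC(2)[OF d that] height d len by (auto simp: double_def)
    then show ?thesis unfolding D using d by metis
  qed
  have double_resp: "double C x' z" if "double C x z" "same_param x x'" for x x' z
  proof -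
    have "fst x' = fst x" "point C x = point C x'"
      using that point_same_param[OF genC(1), of x x'] by (auto simp: double_def same_param_def)
    then show ?thesis
      using that same_param_trans[of x x' z] unfolding double_def by auto
  qed
  have "link_diagram D"
    unfolding link_diagram_def D(1)
  proof (intro conjI allI impI)
    show "generic C" using gen by (simp add: C_def)
  next
    have imp: "over D y" if x: "over D x" and xy: "same_param x y" for x y
    proof -
      obtain z where z: "double C x z" "snd (point K x) > snd (point K z)"
        using x unfolding D by blast
      moreover have "snd (point K x) = snd (point K y)"
        using height[OF _ xy] z len by (auto simp: double_def)
      ultimately show ?thesis
        unfolding D using double_resp[OF z(1) xy] z(2) by metis
    qed
    fix x y assume "same_param x y"
    then show "over D x = over D y"
      using imp same_param_sym by blast
  next
    fix x y assume d: "double C x y"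
    then have d': "double C y x"
      using same_param_sym unfolding double_def by metis
    have "point K x \<noteq> point K y"
      using d link_point_inject[OF link] len by (auto simp: double_def)
    moreover have "fst (point K x) = fst (point K y)"
      using d by (auto simp: double_def C_def point_def)
    ultimately have "snd (point K x) \<noteq> snd (point K y)"
      by (simp add: prod_eq_iff)
    then show "over D x \<noteq> over D y"
      using overD[OF d] overD[OF d'] by auto
  qed
  then show ?thesis
    unfolding diagram_of_def D_def[symmetric]
    using assms(1) overD D(1) C_def by auto
qed

text \<open>
  Projecting along \<open>(- w, 1)\<close> is the same as shearing by \<open>h \<mapsto> h w\<close> and then projecting vertically.
\<close>
lemma polygonal_link_diagram:
  assumes "isotopic L P" "\<forall>c\<in>set P. polygonal c" "\<epsilon> > 0"
  obtains w D where "norm w < \<epsilon>" "diagram_of D L" "strands D = map (\<lambda>c. proj w \<circ> c) P"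
proof -
  have "link P" using assms(1) by (simp add: isotopic_def)
  then obtain w where w: "norm w < \<epsilon>" "generic (map (\<lambda>c. proj w \<circ> c) P)"
    using polygonal_generic_projection assms by blast
  define K where "K = map ((\<circ>) (shear (\<lambda>h. h *\<^sub>R w))) P"
  have eq: "map (\<lambda>c. fst \<circ> c) K = map (\<lambda>c. proj w \<circ> c) P"
    by (auto simp: K_def shear_def proj_def fun_eq_iff)
  have "isotopic L K"
    unfolding K_def by (intro isotopic_shear assms continuous_intros)
  then have "diagram_of (projection_diagram K) L"
    using w eq by (intro diagram_of_projection) auto
  moreover have "strands (projection_diagram K) = map (\<lambda>c. proj w \<circ> c) P"
    using eq by (simp add: projection_diagram_def Let_def)
  ultimately show thesis using w that by blast
qed


section \<open>Piecewise linear deformations\<close>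

text \<open>
  The nodes are added in increasing order.  A new largest node \<open>b\<close> is served by adding a multiple of
  the function that vanishes up to the previous node \<open>m\<close> and is linear beyond it, so that no break
  points other than nodes arise.
\<close>
lemma piecewise_linear_interpolation:
  fixes y :: "real \<Rightarrow> complex"
  assumes "finite B"
  shows "\<exists>\<phi>. continuous_on UNIV \<phi> \<and> (\<forall>x\<in>B. \<phi> x = y x) \<and>
    (\<forall>a b. a < b \<and> {a<..<b} \<inter> B = {} \<longrightarrow> (\<exists>q u. \<forall>t\<in>{a..b}. \<phi> t = q + t *\<^sub>R u))"
  using assms
proof (induction rule: finite_linorder_max_induct)
  case empty
  have "\<exists>q u. \<forall>t\<in>{a..b}. (0 :: complex) = q + t *\<^sub>R u" for a b :: real
    by (intro exI[of _ "0 :: complex"]) simp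
  then show ?case by (intro exI[of _ "\<lambda>_. 0 :: complex"]) simp
next
  case (insert b A)
  show ?case
  proof (cases "A = {}")
    case True
    have "\<exists>q u. \<forall>t\<in>{r..s}. y b = q + t *\<^sub>R u" for r s :: real
      by (intro exI[of _ "y b"] exI[of _ 0]) simp
    then show ?thesis
      unfolding True by (intro exI[of _ "\<lambda>_. y b"]) simp
  next
    case False
    define m where "m = Max A"
    have m: "m \<in> A" "m < b" "\<And>x. x \<in> A \<Longrightarrow> x \<le> m"
      using insert False by (auto simp: m_def)
    obtain \<phi> where \<phi>: "continuous_on UNIV \<phi>" "\<And>x. x \<in> A \<Longrightarrow> \<phi> x = y x"
      "\<And>a b. a < b \<Longrightarrow> {a<..<b} \<inter> A = {} \<Longrightarrow> \<exists>q u. \<forall>t\<in>{a..b}. \<phi> t = q + t *\<^sub>R u"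
      using insert by blast
    define k where "k = (1 / (b - m)) *\<^sub>R (y b - \<phi> b)"
    define \<psi> where "\<psi> x = \<phi> x + max 0 (x - m) *\<^sub>R k" for x
    have "continuous_on UNIV \<psi>"
      unfolding \<psi>_def by (intro continuous_intros \<phi>)
    moreover have "\<psi> x = y x" if "x \<in> insert b A" for x
      using that \<phi>(2) m by (auto simp: \<psi>_def k_def)
    moreover have "\<exists>q u. \<forall>t\<in>{r..s}. \<psi> t = q + t *\<^sub>R u" if rs: "r < s" "{r<..<s} \<inter> insert b A = {}" for r s
    proof -
      obtain q u where q: "\<And>t. t \<in> {r..s} \<Longrightarrow> \<phi> t = q + t *\<^sub>R u"
        using \<phi>(3)[OF rs(1)] rs(2) by blast
      have "m \<notin> {r<..<s}" using m rs(2) by blast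
      then consider "s \<le> m" | "m \<le> r" by fastforce
      then show ?thesis
      proof cases
        case 1
        then show ?thesis
          using q by (intro exI[of _ q] exI[of _ u]) (auto simp: \<psi>_def)
      next
        case 2
        then show ?thesis
          using q by (intro exI[of _ "q - m *\<^sub>R k"] exI[of _ "u + k"]) (auto simp: \<psi>_def algebra_simps)
      qed
    qed
    ultimately show ?thesis by blast
  qed
qed

text \<open>
  The new break points are the old ones and the parameters at which an edge passes a height where \<open>\<phi>\<close>
  breaks.  On horizontal edges \<open>\<phi>\<close> is constant, so they need no further subdivision.
\<close>
lemma polygonal_shear:
  assumes "polygonal c" "finite B"
    and lin: "\<And>a b. a < b \<Longrightarrow> {a<..<b} \<inter> B = {} \<Longrightarrow> \<exists>q u. \<forall>t\<in>{a..b}. \<phi> t = q + t *\<^sub>R u"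
  shows "polygonal (shear \<phi> \<circ> c)"
proof -
  obtain F where F: "finite F" "\<And>e. e \<in> F \<Longrightarrow> is_edge c e"
    "\<And>t. 0 \<le> t \<Longrightarrow> t < 1 \<Longrightarrow> \<exists>a b p v. (a, b, p, v) \<in> F \<and> a \<le> t \<and> t < b"
    using polygonal_edges[OF assms(1)] by blast
  define S where "S = (\<Union>(a, b, p, v)\<in>F. {a, b} \<union> (\<lambda>h. (h - snd p) / snd v) ` B)"
  have fin: "finite S"
    using F(1) assms(2) by (auto simp: S_def)
  have "\<exists>p v. \<forall>t\<in>{a..b}. (shear \<phi> \<circ> c) t = p + t *\<^sub>R v"
    if ab: "0 \<le> a" "a < b" "b \<le> 1" "{a<..<b} \<inter> S = {}" for a b
  proof -
    obtain a0 b0 p v where e: "(a0, b0, p, v) \<in> F" "a0 \<le> (a + b) / 2" "(a + b) / 2 < b0"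
      using F(3)[of "(a + b) / 2"] ab by auto
    have S: "a0 \<in> S" "b0 \<in> S"
      unfolding S_def by (rule UN_I[OF e(1)], simp)+
    have B: "(h - snd p) / snd v \<in> S" if "h \<in> B" for h
      unfolding S_def using imageI[OF that, of "\<lambda>h. (h - snd p) / snd v"]
      by (intro UN_I[OF e(1)]) simp
    \<comment> \<open>The edge is the one that contains the midpoint; as its end points are break points, it reaches
        over all of \<open>[a, b]\<close>.\<close>
    have bounds: "a0 \<le> a" "b \<le> b0"
      using S e ab by (force simp: field_simps)+
    have c: "c t = p + t *\<^sub>R v" if "t \<in> {a..b}" for t
      using F(2)[OF e(1)] that bounds by auto
    have "\<exists>q u. \<forall>t\<in>{a..b}. \<phi> (snd p + t * snd v) = q + t *\<^sub>R u"
    proof (cases "snd v = 0")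
      case True
      then show ?thesis by (intro exI[of _ "\<phi> (snd p)"] exI[of _ 0]) simp
    next
      case False
      define l r where "l = min (snd p + a * snd v) (snd p + b * snd v)"
        and "r = max (snd p + a * snd v) (snd p + b * snd v)"
      have "l < r"
        using False ab by (auto simp: l_def r_def min_def max_def)
      moreover have "{l<..<r} \<inter> B = {}"
      proof (rule ccontr)
        assume "\<not> ?thesis"
        then obtain h where h: "h \<in> B" "l < h" "h < r" by auto
        have "a < (h - snd p) / snd v \<and> (h - snd p) / snd v < b"
        proof (cases "snd v > 0")
          case True
          then have "snd p + a * snd v < h" "h < snd p + b * snd v"
            using h ab by (auto simp: l_def r_def min_def max_def split: if_splits)
          then show ?thesis using True by (simp add: field_simps)
        next
          case neg: False
          then have "snd p + b * snd v < h" "h < snd p + a * snd v"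
            using h ab False by (auto simp: l_def r_def min_def max_def split: if_splits)
          then show ?thesis using neg False by (simp add: field_simps)
        qed
        then show False using B[OF h(1)] ab(4) by auto
      qed
      ultimately obtain q u where q: "\<And>h. h \<in> {l..r} \<Longrightarrow> \<phi> h = q + h *\<^sub>R u"
        using lin by blast
      have "snd p + t * snd v \<in> {l..r}" if "t \<in> {a..b}" for t
      proof (cases "snd v > 0")
        case True
        then have "a * snd v \<le> t * snd v" "t * snd v \<le> b * snd v" using that by auto
        then show ?thesis by (auto simp: l_def r_def)
      next
        case False
        then have "a * snd v \<ge> t * snd v" "t * snd v \<ge> b * snd v"
          using that by (auto intro: mult_right_mono_neg)
        then show ?thesis by (auto simp: l_def r_def)
      qed
      then show ?thesis
        using q by (intro exI[of _ "q + snd p *\<^sub>R u"] exI[of _ "snd v *\<^sub>R u"]) (simp add: algebra_simps)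
    qed
    then obtain q u where "\<And>t. t \<in> {a..b} \<Longrightarrow> \<phi> (snd p + t * snd v) = q + t *\<^sub>R u" by blast
    then show ?thesis
      using c by (intro exI[of _ "p + (q, 0)"] exI[of _ "v + (u, 0)"])
        (simp add: shear_def prod_eq_iff algebra_simps)
  qed
  then show ?thesis
    unfolding polygonal_def by (intro exI[of _ S] conjI fin) simp
qed

lemma polygonal_tilt:
  assumes "polygonal c"
  shows "polygonal (tilt u \<circ> c)"
proof -
  have lin: "tilt u (p + t *\<^sub>R v) = tilt u p + t *\<^sub>R tilt u v" for p t v
    by (simp add: tilt_def inner_add_right algebra_simps)
  obtain S where fin: "finite S" and S: "\<And>a b. 0 \<le> a \<Longrightarrow> a < b \<Longrightarrow> b \<le> 1 \<Longrightarrow> {a<..<b} \<inter> S = {} \<Longrightarrow>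
      \<exists>p v. \<forall>t\<in>{a..b}. c t = p + t *\<^sub>R v"
    using assms unfolding polygonal_def by blast
  have "\<exists>p v. \<forall>t\<in>{a..b}. (tilt u \<circ> c) t = p + t *\<^sub>R v"
    if "0 \<le> a" "a < b" "b \<le> 1" "{a<..<b} \<inter> S = {}" for a b
    using S[OF that] lin by (metis comp_apply)
  then show ?thesis
    unfolding polygonal_def by (intro exI[of _ S] conjI fin) simp
qed

lemma is_edge_tilt:
  assumes "is_edge c (a, b, p, v)"
  shows "is_edge (tilt u \<circ> c) (a, b, tilt u p, tilt u v)"
  using assms by (auto simp: tilt_def inner_add_right algebra_simps)

text \<open>
  For each of the two vectors the bad \<open>u\<close> lie on a line or do not exist.
\<close>
lemma tilt_both_nonhorizontal:
  fixes v v' :: space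
  assumes "v \<noteq> 0" "v' \<noteq> 0"
  obtains u where "snd (tilt u v) \<noteq> 0" "snd (tilt u v') \<noteq> 0"
proof -
  have "negligible {u. fst x \<bullet> u = - snd x}" if "x \<noteq> 0" for x :: space
    using that by (intro negligible_hyperplane) (auto simp: prod_eq_iff)
  then have "negligible ({u. fst v \<bullet> u = - snd v} \<union> {u. fst v' \<bullet> u = - snd v'})"
    using assms by (intro negligible_Un) auto
  moreover have "\<not> negligible (UNIV :: complex set)"
    by (rule open_not_negligible) auto
  ultimately obtain u where "u \<notin> {u. fst v \<bullet> u = - snd v} \<union> {u. fst v' \<bullet> u = - snd v'}"
    by (metis UNIV_eq_I)
  then show thesis
    by (intro that[of u]) (auto simp: tilt_def inner_commute)
qed

lemma edge_parametrized_by_height: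
  assumes "is_edge c (a, b, p, v)" "snd v \<noteq> 0"
  obtains l r \<alpha> \<beta> where "l < r" "\<And>h. h \<in> {l..r} \<Longrightarrow> \<exists>t. c t = (\<alpha> + h *\<^sub>R \<beta>, h)"
proof -
  define l r where "l = min (snd p + a * snd v) (snd p + b * snd v)"
    and "r = max (snd p + a * snd v) (snd p + b * snd v)"
  have ab: "a < b" and c: "\<And>t. a \<le> t \<Longrightarrow> t \<le> b \<Longrightarrow> c t = p + t *\<^sub>R v"
    using assms(1) by auto
  have "a * snd v \<noteq> b * snd v" using assms(2) ab by simp
  then have "l < r"
    unfolding l_def r_def by linarith
  moreover have "\<exists>t. c t = (fst p - (snd p / snd v) *\<^sub>R fst v + h *\<^sub>R ((1 / snd v) *\<^sub>R fst v), h)"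
    if "h \<in> {l..r}" for h
  proof -
    have "a \<le> (h - snd p) / snd v \<and> (h - snd p) / snd v \<le> b"
    proof (cases "snd v > 0")
      case True
      then have "a * snd v \<le> b * snd v" using ab by simp
      then have "snd p + a * snd v \<le> h" "h \<le> snd p + b * snd v"
        using that unfolding l_def r_def by auto
      then show ?thesis using True by (simp add: field_simps)
    next
      case False
      then have "b * snd v \<le> a * snd v" using ab by (simp add: mult_right_mono_neg)
      then have "snd p + b * snd v \<le> h" "h \<le> snd p + a * snd v"
        using that unfolding l_def r_def by auto
      then show ?thesis using False assms(2) by (simp add: field_simps)
    qed
    then have "c ((h - snd p) / snd v) = p + ((h - snd p) / snd v) *\<^sub>R v"
      using c by blast
    also have "\<dots> = (fst p - (snd p / snd v) *\<^sub>R fst v + h *\<^sub>R ((1 / snd v) *\<^sub>R fst v), h)"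
      using assms(2) by (simp add: prod_eq_iff diff_divide_distrib scaleR_diff_left)
    finally show ?thesis by blast
  qed
  ultimately show thesis by (rule that)
qed

lemma disjoint_subintervals:
  fixes l0 r0 l1 r1 :: real
  assumes "l0 < r0" "l1 < r1"
  obtains a0 b0 a1 b1 where "l0 \<le> a0" "a0 < b0" "b0 \<le> r0" "l1 \<le> a1" "a1 < b1" "b1 \<le> r1" "b0 < a1 \<or> b1 < a0"
proof (cases "(l0 + r0) / 2 \<le> (l1 + r1) / 2")
  case True
  then show ?thesis
    using assms that[of l0 "(3 * l0 + r0) / 4" "(l1 + r1) / 2" r1] by (simp add: field_simps)
next
  case False
  then show ?thesis
    using assms that[of "(l0 + r0) / 2" r0 l1 "(3 * l1 + r1) / 4"] by (simp add: field_simps)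
qed


section \<open>Diagrams with many mixed crossings\<close>

text \<open>
  A path that stays close to the imaginary axis and leads from near \<open>\<i>\<close> to near \<open>- \<i>\<close>, or back, meets
  a segment from near \<open>- 1\<close> to near \<open>1\<close>.  The path changes sides of the line through the segment, and the
  meeting point lies on the segment since its real part is small.  The end points
  of the path are excluded, so that consecutive pieces of a zigzag have different crossings.
\<close>
lemma path_crosses_segment:
  fixes \<gamma> :: "real \<Rightarrow> complex"
  assumes cont: "continuous_on {a..b} \<gamma>" and "a \<le> b"
    and re: "\<And>h. h \<in> {a..b} \<Longrightarrow> \<bar>Re (\<gamma> h)\<bar> \<le> 1 / 8"
    and im: "Im (\<gamma> a) \<ge> 7 / 8 \<and> Im (\<gamma> b) \<le> - 7 / 8 \<or> Im (\<gamma> b) \<ge> 7 / 8 \<and> Im (\<gamma> a) \<le> - 7 / 8"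
    and z: "norm (z + 1) \<le> 1 / 8" and z': "norm (z' - 1) \<le> 1 / 8"
  obtains h r where "h \<in> {a<..<b}" "r \<in> {0..1}" "\<gamma> h = z + r *\<^sub>R (z' - z)"
proof -
  have zz: "\<bar>Re z + 1\<bar> \<le> 1 / 8" "\<bar>Im z\<bar> \<le> 1 / 8" "\<bar>Re z' - 1\<bar> \<le> 1 / 8" "\<bar>Im z'\<bar> \<le> 1 / 8"
    using abs_Re_le_cmod[of "z + 1"] abs_Im_le_cmod[of "z + 1"] abs_Re_le_cmod[of "z' - 1"]
      abs_Im_le_cmod[of "z' - 1"] z z' by simp_all
  define d where "d = z' - z"
  have d: "Re d \<ge> 7 / 4" "\<bar>Im d\<bar> \<le> 1 / 4"
    unfolding d_def minus_complex.sel using zz by linarith+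
  \<comment> \<open>The sign of \<open>f\<close> tells the side of the line through the segment.\<close>
  define f where "f h = cross d (\<gamma> h - z)" for h
  have f: "f h = Re d * (Im (\<gamma> h) - Im z) - Im d * (Re (\<gamma> h) - Re z)" for h
    by (simp add: f_def cross_def)
  have small: "\<bar>Im d * (Re (\<gamma> h) - Re z)\<bar> \<le> 1 / 4 * (5 / 4)" if "h \<in> {a..b}" for h
  proof -
    have "\<bar>Re (\<gamma> h) - Re z\<bar> \<le> 5 / 4" using re[OF that] zz by linarith
    then show ?thesis unfolding abs_mult using d(2) by (intro mult_mono) auto
  qed
  have pos: "f h > 0" if "h \<in> {a..b}" "Im (\<gamma> h) \<ge> 7 / 8" for h
  proof -
    have "Im (\<gamma> h) - Im z \<ge> 3 / 4" using zz that(2) by linarith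
    then have "Re d * (Im (\<gamma> h) - Im z) \<ge> 7 / 4 * (3 / 4)"
      using d by (intro mult_mono) auto
    then show ?thesis using small[OF that(1)] unfolding f by linarith
  qed
  have neg: "f h < 0" if "h \<in> {a..b}" "Im (\<gamma> h) \<le> - 7 / 8" for h
  proof -
    have "Im z - Im (\<gamma> h) \<ge> 3 / 4" using zz that(2) by linarith
    then have "Re d * (Im z - Im (\<gamma> h)) \<ge> 7 / 4 * (3 / 4)"
      using d by (intro mult_mono) auto
    moreover have "Re d * (Im z - Im (\<gamma> h)) = - (Re d * (Im (\<gamma> h) - Im z))"
      by (simp add: algebra_simps)
    ultimately show ?thesis using small[OF that(1)] unfolding f by linarith
  qed
  have contf: "continuous_on {a..b} f"
    unfolding f by (intro continuous_intros cont)
  have ab: "a \<in> {a..b}" "b \<in> {a..b}" using \<open>a \<le> b\<close> by auto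
  have "\<exists>h\<ge>a. h \<le> b \<and> f h = 0"
    using im
  proof
    assume "Im (\<gamma> a) \<ge> 7 / 8 \<and> Im (\<gamma> b) \<le> - 7 / 8"
    then show ?thesis
      using pos[OF ab(1)] neg[OF ab(2)] by (intro IVT2' contf \<open>a \<le> b\<close>) auto
  next
    assume "Im (\<gamma> b) \<ge> 7 / 8 \<and> Im (\<gamma> a) \<le> - 7 / 8"
    then show ?thesis
      using pos[OF ab(2)] neg[OF ab(1)] by (intro IVT' contf \<open>a \<le> b\<close>) auto
  qed
  then obtain h where h: "h \<in> {a..b}" "f h = 0" by auto
  have "d \<noteq> 0" using d by auto
  then obtain r where r: "\<gamma> h - z = r *\<^sub>R d"
    using cross_eq_0_imp_parallel h(2) unfolding f_def by blast
  have eq: "\<gamma> h = z + r *\<^sub>R (z' - z)"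
    using r by (simp add: d_def algebra_simps)
  have rr: "Re (\<gamma> h) - Re z = r * Re d"
    using r by (simp add: complex_eq_iff)
  have "Re (\<gamma> h) - Re z \<ge> 0" "Re (\<gamma> h) - Re z \<le> Re d"
    using re[OF h(1)] zz d by linarith+
  then have r01: "0 \<le> r" "r \<le> 1"
    unfolding rr using d by (simp_all add: zero_le_mult_iff mult_le_cancel_right1)
  have "f a \<noteq> 0" "f b \<noteq> 0"
    using im pos[OF ab(1)] neg[OF ab(1)] pos[OF ab(2)] neg[OF ab(2)] by auto
  then have "h \<in> {a<..<b}"
    using h by (metis atLeastAtMost_iff greaterThanLessThan_iff order_le_less)
  then show thesis using that r01 eq by auto
qed

text \<open>
  The function \<open>\<phi>\<close> interpolates in such a way that, seen from above, the strand of component \<open>1\<close> runs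
  straight from \<open>- 1\<close> to \<open>1\<close>, while the strand of component \<open>0\<close> goes back and forth between \<open>\<i>\<close> and
  \<open>- \<i>\<close>.  This is possible since the strands occupy disjoint ranges of heights.  A direction
  of projection that deviates so little from the vertical that the relevant points move by at most
  \<open>1 / 8\<close> keeps a crossing for each of the \<open>N\<close> pieces of the zigzag.
\<close>
lemma zigzag_diagram:
  assumes Q: "isotopic L Q" "\<forall>c\<in>set Q. polygonal c" "length Q \<ge> 2"
    and lr: "l0 < r0" "l1 < r1" "r0 < l1 \<or> r1 < l0"
    and strand0: "\<And>h. h \<in> {l0..r0} \<Longrightarrow> \<exists>t. (Q ! 0) t = (\<alpha>0 + h *\<^sub>R \<beta>0, h)"
    and strand1: "\<And>h. h \<in> {l1..r1} \<Longrightarrow> \<exists>t. (Q ! 1) t = (\<alpha>1 + h *\<^sub>R \<beta>1, h)"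
    and "N > 0"
  shows "\<exists>D. diagram_of D L \<and> N \<le> mixed_crossing_number D"
proof -
  define \<delta> where "\<delta> = (r0 - l0) / real N"
  have \<delta>: "\<delta> > 0" "l0 + real N * \<delta> = r0"
    using lr(1) \<open>N > 0\<close> by (auto simp: \<delta>_def)
  define x where "x k = l0 + real k * \<delta>" for k
  have x_in: "x k \<in> {l0..r0}" if "k \<le> N" for k
  proof -
    have "0 \<le> real k * \<delta>" "real k * \<delta> \<le> real N * \<delta>" using that \<delta>(1) by auto
    then show ?thesis using \<delta>(2) unfolding x_def by auto
  qed
  have x_mono: "x j \<le> x k" if "j \<le> k" for j k
    using that \<delta>(1) by (auto simp: x_def)
  have x_step: "x k < x (Suc k)" for k
    using \<delta>(1) by (simp add: x_def)
  define B where "B = {l1, r1} \<union> x ` {..N}"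
  define zig where "zig k = (if even k then \<i> else - \<i>)" for k :: int
  \<comment> \<open>At the node \<open>x k\<close> the rounded quotient is \<open>k\<close>, so \<open>y\<close> moves the first strand to \<open>zig k\<close> there.\<close>
  define y where "y h = (if h = l1 then - 1 - (\<alpha>1 + h *\<^sub>R \<beta>1) else if h = r1 then 1 - (\<alpha>1 + h *\<^sub>R \<beta>1)
    else zig (round ((h - l0) / \<delta>)) - (\<alpha>0 + h *\<^sub>R \<beta>0))" for h
  have "finite B" by (simp add: B_def)
  then obtain \<phi> where cont: "continuous_on UNIV \<phi>" and interp: "\<And>h. h \<in> B \<Longrightarrow> \<phi> h = y h"
    and lin: "\<And>a b. a < b \<Longrightarrow> {a<..<b} \<inter> B = {} \<Longrightarrow> \<exists>q u. \<forall>t\<in>{a..b}. \<phi> t = q + t *\<^sub>R u"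
    using piecewise_linear_interpolation[of B y] by blast
  define R where "R = map ((\<circ>) (shear \<phi>)) Q"
  have R: "isotopic L R" "\<forall>c\<in>set R. polygonal c" "length R \<ge> 2"
    using isotopic_shear[OF Q(1) cont] polygonal_shear[OF _ \<open>finite B\<close> lin] Q(2,3)
    by (auto simp: R_def)
  have R01: "R ! 0 = shear \<phi> \<circ> Q ! 0" "R ! 1 = shear \<phi> \<circ> Q ! 1"
  proof -
    have "0 < length Q" "1 < length Q" using Q(3) by linarith+
    then show "R ! 0 = shear \<phi> \<circ> Q ! 0" "R ! 1 = shear \<phi> \<circ> Q ! 1" by (simp_all add: R_def)
  qed
  \<comment> \<open>All heights of the two strands are bounded by \<open>M\<close>.\<close>
  define M where "M = 1 + \<bar>l0\<bar> + \<bar>r0\<bar> + \<bar>l1\<bar> + \<bar>r1\<bar>"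
  have "M > 0" by (simp add: M_def add_pos_nonneg)
  obtain w D where w: "norm w < 1 / (8 * M)" and D: "diagram_of D L" "strands D = map (\<lambda>c. proj w \<circ> c) R"
    using polygonal_link_diagram[OF R(1,2), of "1 / (8 * M)"] \<open>M > 0\<close> by auto
  have hw: "norm (h *\<^sub>R w) \<le> 1 / 8" if "h \<in> {l0..r0} \<or> h \<in> {l1..r1}" for h
  proof -
    have "\<bar>h\<bar> \<le> M" using that by (auto simp: M_def)
    then have "\<bar>h\<bar> * norm w \<le> M * (1 / (8 * M))"
      using w by (intro mult_mono) auto
    then show ?thesis using \<open>M > 0\<close> by simp
  qed
  define g0 g1 where "g0 h = \<alpha>0 + h *\<^sub>R \<beta>0 + \<phi> h" and "g1 h = \<alpha>1 + h *\<^sub>R \<beta>1 + \<phi> h" for h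
  have on0: "\<exists>t. (R ! 0) t = (g0 h, h)" if h: "h \<in> {l0..r0}" for h
  proof -
    obtain t where "(Q ! 0) t = (\<alpha>0 + h *\<^sub>R \<beta>0, h)" using strand0[OF h] by blast
    then show ?thesis by (intro exI[of _ t]) (simp add: R01 shear_def g0_def)
  qed
  have on1: "\<exists>t. (R ! 1) t = (g1 h, h)" if h: "h \<in> {l1..r1}" for h
  proof -
    obtain t where "(Q ! 1) t = (\<alpha>1 + h *\<^sub>R \<beta>1, h)" using strand1[OF h] by blast
    then show ?thesis unfolding R01 by (intro exI[of _ t]) (simp add: shear_def g1_def)
  qed
  have g0_x: "g0 (x k) = zig (int k)" if "k \<le> N" for k
  proof -
    have "x k \<noteq> l1" "x k \<noteq> r1" using x_in[OF that] lr by auto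
    moreover have "round ((x k - l0) / \<delta>) = int k"
      using \<delta>(1) by (simp add: x_def)
    moreover have "x k \<in> B" using that by (simp add: B_def)
    ultimately show ?thesis
      using interp by (simp add: g0_def y_def)
  qed
  have g1_ends: "g1 l1 = - 1" "g1 r1 = 1"
    using interp lr by (auto simp: g1_def y_def B_def)
  have between: "l1 + r * (r1 - l1) \<in> {l1..r1}" if "r \<in> {0..1}" for r
  proof -
    have "0 \<le> r * (r1 - l1)" "r * (r1 - l1) \<le> r1 - l1"
      using that lr(2) by (auto intro: mult_left_le_one_le)
    then show ?thesis unfolding atLeastAtMost_iff by linarith
  qed
  have g1_affine: "g1 (l1 + r * (r1 - l1)) = - 1 + (2 * r) *\<^sub>R 1" if r: "r \<in> {0..1}" for r
  proof -
    have "{l1<..<r1} \<inter> B = {}"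
      using x_in lr by (force simp: B_def)
    then obtain q u where q: "\<And>h. h \<in> {l1..r1} \<Longrightarrow> \<phi> h = q + h *\<^sub>R u"
      using lin[OF lr(2)] by blast
    then have g: "g1 h = (\<alpha>1 + q) + h *\<^sub>R (\<beta>1 + u)" if "h \<in> {l1..r1}" for h
      using that by (simp add: g1_def algebra_simps)
    from between[OF r] have "g1 (l1 + r * (r1 - l1)) = (\<alpha>1 + q) + (l1 + r * (r1 - l1)) *\<^sub>R (\<beta>1 + u)"
      by (rule g)
    also have "\<dots> = g1 l1 + r *\<^sub>R (g1 r1 - g1 l1)"
      using lr(2) g[of l1] g[of r1] by (simp add: algebra_simps)
    finally show ?thesis unfolding g1_ends by (simp add: scaleR_conv_of_real)
  qed
  have Re_g0: "Re (g0 h) = 0" if k: "k < N" and h: "h \<in> {x k..x (Suc k)}" for k h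
  proof -
    have "{x k<..<x (Suc k)} \<inter> B = {}"
    proof -
      have "x k \<in> {l0..r0}" "x (Suc k) \<in> {l0..r0}" using x_in k by auto
      then have "l1 \<notin> {x k<..<x (Suc k)}" "r1 \<notin> {x k<..<x (Suc k)}" using lr by auto
      moreover have "x j \<notin> {x k<..<x (Suc k)}" for j
        using x_mono[of j k] x_mono[of "Suc k" j] by (cases "j \<le> k") auto
      ultimately show ?thesis by (auto simp: B_def)
    qed
    then obtain q u where q: "\<And>h. h \<in> {x k..x (Suc k)} \<Longrightarrow> \<phi> h = q + h *\<^sub>R u"
      using lin[OF x_step[of k]] by blast
    then have g: "Re (g0 h) = Re (\<alpha>0 + q) + h * Re (\<beta>0 + u)" if "h \<in> {x k..x (Suc k)}" for h
      using that by (simp add: g0_def algebra_simps)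
    have "Re (g0 (x k)) = 0" "Re (g0 (x (Suc k))) = 0"
      using g0_x[of k] g0_x[of "Suc k"] k by (auto simp: zig_def)
    then have e: "Re (\<alpha>0 + q) + x k * Re (\<beta>0 + u) = 0" "Re (\<alpha>0 + q) + x (Suc k) * Re (\<beta>0 + u) = 0"
      using g[of "x k"] g[of "x (Suc k)"] x_step[of k] by auto
    then have "(x (Suc k) - x k) * Re (\<beta>0 + u) = 0"
      by (simp add: algebra_simps)
    then have "Re (\<beta>0 + u) = 0" using x_step[of k] by simp
    then show ?thesis using g[OF h] e by simp
  qed
  have "\<exists>h h'. h \<in> {x k<..<x (Suc k)} \<and> h' \<in> {l1..r1} \<and> g0 h + h *\<^sub>R w = g1 h' + h' *\<^sub>R w"
    if k: "k < N" for k
  proof -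
    have sub: "{x k..x (Suc k)} \<subseteq> {l0..r0}"
      using x_in[of k] x_in[of "Suc k"] k by auto
    have comp: "\<bar>Re (h *\<^sub>R w)\<bar> \<le> 1 / 8" "\<bar>Im (h *\<^sub>R w)\<bar> \<le> 1 / 8" if "h \<in> {l0..r0} \<or> h \<in> {l1..r1}" for h
      using hw[OF that] abs_Re_le_cmod[of "h *\<^sub>R w"] abs_Im_le_cmod[of "h *\<^sub>R w"] by linarith+
    have 1: "continuous_on {x k..x (Suc k)} (\<lambda>h. g0 h + h *\<^sub>R w)"
      unfolding g0_def by (intro continuous_intros continuous_on_subset[OF cont]) auto
    have 2: "x k \<le> x (Suc k)" using x_step[of k] by simp
    have 3: "\<bar>Re (g0 h + h *\<^sub>R w)\<bar> \<le> 1 / 8" if "h \<in> {x k..x (Suc k)}" for h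
      using Re_g0[OF k that] comp(1)[of h] sub that by auto
    have 4: "Im (g0 (x k) + x k *\<^sub>R w) \<ge> 7 / 8 \<and> Im (g0 (x (Suc k)) + x (Suc k) *\<^sub>R w) \<le> - 7 / 8 \<or>
      Im (g0 (x (Suc k)) + x (Suc k) *\<^sub>R w) \<ge> 7 / 8 \<and> Im (g0 (x k) + x k *\<^sub>R w) \<le> - 7 / 8"
      using g0_x[of k] g0_x[of "Suc k"] k comp(2)[of "x k"] comp(2)[of "x (Suc k)"] x_in[of k] x_in[of "Suc k"]
      by (cases "even k") (auto simp: zig_def)
    have 5: "norm ((- 1 + l1 *\<^sub>R w) + 1) \<le> 1 / 8" "norm ((1 + r1 *\<^sub>R w) - 1) \<le> 1 / 8"
      using hw[of l1] hw[of r1] lr(2) by auto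
    obtain h r where h: "h \<in> {x k<..<x (Suc k)}" "r \<in> {0..1}"
      "g0 h + h *\<^sub>R w = (- 1 + l1 *\<^sub>R w) + r *\<^sub>R ((1 + r1 *\<^sub>R w) - (- 1 + l1 *\<^sub>R w))"
      using path_crosses_segment[OF 1 2 3 4 5] by blast
    have "g0 h + h *\<^sub>R w = g1 (l1 + r * (r1 - l1)) + (l1 + r * (r1 - l1)) *\<^sub>R w"
      unfolding h(3) g1_affine[OF h(2)] by (simp add: algebra_simps scaleR_conv_of_real)
    then show ?thesis using h(1) between[OF h(2)] by blast
  qed
  then obtain h h' where h: "\<And>k. k < N \<Longrightarrow> h k \<in> {x k<..<x (Suc k)}" "\<And>k. k < N \<Longrightarrow> h' k \<in> {l1..r1}"
    and meet: "\<And>k. k < N \<Longrightarrow> g0 (h k) + h k *\<^sub>R w = g1 (h' k) + h' k *\<^sub>R w"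
    by metis
  have "\<exists>t. (R ! 0) t = (g0 (h k), h k)" if "k < N" for k
    using h(1)[OF that] x_in[of k] x_in[of "Suc k"] that by (intro on0) auto
  then obtain t where t: "\<And>k. k < N \<Longrightarrow> (R ! 0) (t k) = (g0 (h k), h k)" by metis
  have "\<exists>t. (R ! 1) t = (g1 (h' k), h' k)" if "k < N" for k
    using h(2)[OF that] by (rule on1)
  then obtain t' where t': "\<And>k. k < N \<Longrightarrow> (R ! 1) (t' k) = (g1 (h' k), h' k)" by metis
  define z where "z k = g0 (h k) + h k *\<^sub>R w" for k
  define C where "C = strands D"
  have gen: "generic C"
    using D(1) by (simp add: diagram_of_def link_diagram_def C_def)
  have lenR: "0 < length R" "1 < length R" using R(3) by linarith+
  have len: "0 < length C" "1 < length C" unfolding C_def D(2) using lenR by simp_all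
  have C0: "(C ! 0) (t k) = z k" and C1: "(C ! 1) (t' k) = z k" if "k < N" for k
    using t[OF that] t'[OF that] meet[OF that] lenR by (simp_all add: C_def D(2) z_def proj_def)
  have "z ` {..<N} \<subseteq> mixed_crossings C"
  proof
    fix u assume "u \<in> z ` {..<N}"
    then obtain k where "k < N" "u = z k" by auto
    then have "u \<in> range (C ! 0)" "u \<in> range (C ! 1)" using C0 C1 by (metis rangeI)+
    then show "u \<in> mixed_crossings C"
      unfolding mixed_crossings_def using len zero_neq_one by blast
  qed
  \<comment> \<open>If two crossings coincided, the plane point would be passed twice by component \<open>0\<close>, at different
      heights, and once by component \<open>1\<close>.\<close>
  moreover have "inj_on z {..<N}"
  proof (rule linorder_inj_onI)
    fix j k assume "j < k" and jk: "j \<in> {..<N}" "k \<in> {..<N}"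
    show "z j \<noteq> z k"
    proof
      assume eq: "z j = z k"
      have "h j < h k"
        using h(1)[of j] h(1)[of k] jk x_mono[of "Suc j" k] \<open>j < k\<close> by auto
      moreover have "closed_curve (R ! 0)"
        using R(1) lenR(1) by (auto simp: isotopic_def link_def)
      ultimately have "\<not> same_param (0, t j) (0, t k)"
        using closed_curve_shift[of "R ! 0" "t j" "t k"] t jk by (auto simp: same_param_def)
      then have "double C (0, t j) (0, t k)"
        using C0 jk eq len by (auto simp: double_def point_def)
      moreover have "double C (0, t j) (1, t' j)"
        using C0 C1 jk len by (auto simp: double_def point_def same_param_def)
      ultimately have "same_param (0, t k) (1, t' j)"
        by (rule generic_double_unique[OF gen])
      then show False by (simp add: same_param_def)
    qed
  qed auto
  ultimately have "N \<le> card (mixed_crossings C)"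
    using card_mono[OF finite_mixed_crossings[OF gen], of "z ` {..<N}"] by (simp add: card_image)
  then show ?thesis
    using D(1) unfolding mixed_crossing_number_def C_def by blast
qed

text \<open>
  First the heights are tilted such that an edge of component \<open>0\<close> and an edge of component \<open>1\<close> are not
  horizontal; then pieces of them occupy disjoint ranges of heights.
\<close>
lemma diagram_with_many_mixed_crossings:
  assumes P: "isotopic L P" "\<forall>c\<in>set P. polygonal c" "length P \<ge> 2" and "N > 0"
  obtains D where "diagram_of D L" "N \<le> mixed_crossing_number D"
proof -
  have link: "link P" using P(1) by (simp add: isotopic_def)
  obtain a0 b0 p0 v0 where e0: "is_edge (P ! 0) (a0, b0, p0, v0)" "v0 \<noteq> 0"
    by (rule nonconstant_edge_exists[OF link P(2), of 0]) (use P(3) in linarith, blast)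
  obtain a1 b1 p1 v1 where e1: "is_edge (P ! 1) (a1, b1, p1, v1)" "v1 \<noteq> 0"
    by (rule nonconstant_edge_exists[OF link P(2), of 1]) (use P(3) in linarith, blast)
  obtain u where u: "snd (tilt u v0) \<noteq> 0" "snd (tilt u v1) \<noteq> 0"
    using tilt_both_nonhorizontal[OF e0(2) e1(2)] by blast
  define Q where "Q = map ((\<circ>) (tilt u)) P"
  have Q: "isotopic L Q" "\<forall>c\<in>set Q. polygonal c" "length Q \<ge> 2"
    using isotopic_tilt[OF P(1)] polygonal_tilt P(2,3) by (auto simp: Q_def)
  have Q01: "Q ! 0 = tilt u \<circ> P ! 0" "Q ! 1 = tilt u \<circ> P ! 1"
  proof -
    have "0 < length P" "1 < length P" using P(3) by linarith+
    then show "Q ! 0 = tilt u \<circ> P ! 0" "Q ! 1 = tilt u \<circ> P ! 1" by (simp_all add: Q_def)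
  qed
  obtain l0 r0 \<alpha>0 \<beta>0 where s0: "l0 < r0" "\<And>h. h \<in> {l0..r0} \<Longrightarrow> \<exists>t. (Q ! 0) t = (\<alpha>0 + h *\<^sub>R \<beta>0, h)"
    using edge_parametrized_by_height[OF is_edge_tilt[OF e0(1)] u(1)] unfolding Q01 by metis
  obtain l1 r1 \<alpha>1 \<beta>1 where s1: "l1 < r1" "\<And>h. h \<in> {l1..r1} \<Longrightarrow> \<exists>t. (Q ! 1) t = (\<alpha>1 + h *\<^sub>R \<beta>1, h)"
    using edge_parametrized_by_height[OF is_edge_tilt[OF e1(1)] u(2)] unfolding Q01 by metis
  obtain x0 y0 x1 y1 where xy: "l0 \<le> x0" "x0 < y0" "y0 \<le> r0" "l1 \<le> x1" "x1 < y1" "y1 \<le> r1" "y0 < x1 \<or> y1 < x0"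
    using disjoint_subintervals[OF s0(1) s1(1)] by metis
  have "\<exists>D. diagram_of D L \<and> N \<le> mixed_crossing_number D"
  proof (rule zigzag_diagram[OF Q xy(2,5,7) _ _ \<open>N > 0\<close>])
    show "\<exists>t. (Q ! 0) t = (\<alpha>0 + h *\<^sub>R \<beta>0, h)" if "h \<in> {x0..y0}" for h
      using that xy by (intro s0(2)) auto
    show "\<exists>t. (Q ! 1) t = (\<alpha>1 + h *\<^sub>R \<beta>1, h)" if "h \<in> {x1..y1}" for h
      using that xy by (intro s1(2)) auto
  qed
  then show thesis using that by blast
qed


section \<open>Generating sets contain both directions of \<open>\<Omega>2\<close>\<close>

theorem theorem6:
  fixes L :: "space curves" and A :: "directed_move set"
  assumes "tame_link L" and "length L \<ge> 2" and "generating L A"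
  shows "(\<exists>parallel pos. (Omega2 parallel pos, Forward) \<in> A) \<and>
         (\<exists>parallel pos. (Omega2 parallel pos, Backward) \<in> A)"
proof -
  obtain P where P: "isotopic L P" "\<forall>c\<in>set P. polygonal c"
    using assms(1) unfolding tame_link_def by blast
  then have "length P \<ge> 2"
    using assms(2) unfolding isotopic_def carries_def by auto
  obtain D where D: "diagram_of D L"
    using polygonal_link_diagram[OF P, of 1] by auto
  obtain D' where D': "diagram_of D' L" "Suc (mixed_crossing_number D) \<le> mixed_crossing_number D'"
    using diagram_with_many_mixed_crossings[OF P \<open>length P \<ge> 2\<close>, of "Suc (mixed_crossing_number D)"] by blast
  let ?step = "\<lambda>E E'. planar_isotopic E E' \<or> (\<exists>m\<in>A. performs m E E')"
  have "?step\<^sup>*\<^sup>* D D'" "?step\<^sup>*\<^sup>* D' D"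
    using assms(3) D D'(1) unfolding generating_def by blast+
  then show ?thesis
    using without_forward_omega2_nonincreasing[of A D D'] without_backward_omega2_nondecreasing[of A D' D]
      D'(2) by (metis not_less_eq_eq order_refl order_trans)
qed

end
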